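(* Let $V=\mathbb{R}^{k,l}$ and let $\eta\in\Lambda^3V$ have isotropic support. The group $(\mathcal{L}(\eta),h)$ admits lattices $\Gamma\subset\mathcal{L}(\eta)$, provided that $\eta$ has rational coefficients with respect to some basis of $V$. For a lattice $\Gamma\subset\mathcal{L}(\eta)$, the quotient $M=M(\eta,\Gamma):=\Gamma\setminus\mathcal{L}(\eta)$, with the metric induced by $h$, is a flat compact homogeneous pseudo-Riemannian manifold. The connected component of the identity in the isometry group of $M$ is the image of the natural group homomorphism $\pi$ from $\mathcal{L}(\eta)$ into the isometry group of $M$.
   Context: Let $V=\mathbb{R}^{k,l}=(\mathbb{R}^n,\langle\cdot,\cdot\rangle)$, $n=k+l$, be the standard pseudo-Euclidean vector space of signature $(k,l)$. Using the scalar product to identify $V\cong V^*$, $\Lambda^2V\cong\mathfrak{so}(V)$, a three-vector $\eta\in\Lambda^3V$ is regarded as an alternating trilinear form, and $\eta_X\in\mathfrak{so}(V)$, $X\in V$, is defined by $\langle\eta_XY,Z\rangle=\eta(X,Y,Z)$. The support of $\eta$ is $\Sigma_\eta:=\mathrm{span}\{\eta_XY\mid X,Y\in V\}$. When $\Sigma_\eta$ is totally isotropic, $\mathcal{L}(\eta):=\{g_X\mid X\in V\}\subset\mathrm{Isom}(V)$ is the group of affine isometries $g_X(x)=(\mathbb{1}+\eta_X)x+X$; it is a simply connected 2-step nilpotent Lie group acting simply transitively on $V$, and $h$ is the flat bi-invariant metric on $\mathcal{L}(\eta)$ obtained by pulling back the scalar product by the orbit map $\mathcal{L}(\eta)\ni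 g\mapsto g0\in V$. A lattice is a discrete co-compact subgroup. The homomorphism $\pi:\mathcal{L}(\eta)\to\mathrm{Isom}(M)$ is given by the action by right multiplication, $\pi(g)(\Gamma x)=\Gamma xg^{-1}$. *)

theory Defs
  imports "HOL-Analysis.Analysis" "HOL-Algebra.Coset" "HOL-Algebra.Bij"
begin

section \<open>Smooth and pseudo-Riemannian manifolds\<close>

text \<open>Differentiability classes of maps on open sets.\<close>

fun Ck_on :: "nat \<Rightarrow> 'a set \<Rightarrow> ('a::real_normed_vector \<Rightarrow> 'b::real_normed_vector) \<Rightarrow> bool" where
  "Ck_on 0 S f \<longleftrightarrow> continuous_on S f"
| "Ck_on (Suc k) S f \<longleftrightarrow>
     (\<forall>x\<in>S. f differentiable (at x)) \<and> (\<forall>v. Ck_on k S (\<lambda>x. frechet_derivative f (at x) v))"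

definition smooth_on :: "'a set \<Rightarrow> ('a::real_normed_vector \<Rightarrow> 'b::real_normed_vector) \<Rightarrow> bool" where
  "smooth_on S f \<longleftrightarrow> (\<forall>k. Ck_on k S f)"

text \<open>
  Raw data of a manifold with a metric: an underlying topological space, an indexed atlas
  (the \<open>i\<close>-th chart is \<open>chart_map i\<close> on \<open>chart_dom i\<close>), and a metric
  tensor given by its component matrices; \<open>chart_metric i x\<close> is the Gram matrix of the
  coordinate frame of the \<open>i\<close>-th chart at the point with coordinates \<open>x\<close>.
\<close>

record ('a, 'i, 'n) mfd =
  mtop :: "'a topology"
  chart_idx :: "'i set"
  chart_dom :: "'i \<Rightarrow> 'a set"
  chart_map :: "'i \<Rightarrow> 'a \<Rightarrow> real^'n"
  chart_metric :: "'i \<Rightarrow> real^'n \<Rightarrow> real^'n^'n"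

definition chart_img :: "('a, 'i, 'n::finite) mfd \<Rightarrow> 'i \<Rightarrow> (real^'n) set" where
  "chart_img M i = chart_map M i ` chart_dom M i"

definition chart_inv :: "('a, 'i, 'n::finite) mfd \<Rightarrow> 'i \<Rightarrow> real^'n \<Rightarrow> 'a" where
  "chart_inv M i = the_inv_into (chart_dom M i) (chart_map M i)"

text \<open>Local representative of \<open>f\<close> in charts \<open>i\<close>, \<open>j\<close>, and the subset of
  coordinate space on which it is defined.\<close>

definition local_rep ::
  "('a, 'i, 'n::finite) mfd \<Rightarrow> 'i \<Rightarrow> ('b, 'j, 'm::finite) mfd \<Rightarrow> 'j \<Rightarrow> ('a \<Rightarrow> 'b) \<Rightarrow> real^'n \<Rightarrow> real^'m"
  where "local_rep M i N j f = chart_map N j \<circ> f \<circ> chart_inv M i"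

definition local_dom ::
  "('a, 'i, 'n::finite) mfd \<Rightarrow> 'i \<Rightarrow> ('b, 'j, 'm::finite) mfd \<Rightarrow> 'j \<Rightarrow> ('a \<Rightarrow> 'b) \<Rightarrow> (real^'n) set"
  where "local_dom M i N j f = chart_map M i ` {p \<in> chart_dom M i. f p \<in> chart_dom N j}"

definition smooth_in_charts ::
  "('a, 'i, 'n::finite) mfd \<Rightarrow> ('b, 'j, 'm::finite) mfd \<Rightarrow> ('a \<Rightarrow> 'b) \<Rightarrow> bool" where
  "smooth_in_charts M N f \<longleftrightarrow>
     (\<forall>i\<in>chart_idx M. \<forall>j\<in>chart_idx N. smooth_on (local_dom M i N j f) (local_rep M i N j f))"

text \<open>The pullback under \<open>f\<close> of the metric of \<open>N\<close> is the metric of \<open>M\<close>.\<close>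

definition preserves_metric ::
  "('a, 'i, 'n::finite) mfd \<Rightarrow> ('b, 'j, 'm::finite) mfd \<Rightarrow> ('a \<Rightarrow> 'b) \<Rightarrow> bool" where
  "preserves_metric M N f \<longleftrightarrow>
     (\<forall>i\<in>chart_idx M. \<forall>j\<in>chart_idx N. \<forall>x\<in>local_dom M i N j f.
        let D = jacobian (local_rep M i N j f) (at x)
        in chart_metric M i x = transpose D ** chart_metric N j (local_rep M i N j f x) ** D)"

definition smooth_manifold :: "('a, 'i, 'n::finite) mfd \<Rightarrow> bool" where
  "smooth_manifold M \<longleftrightarrow>
     Hausdorff_space (mtop M) \<and> second_countable (mtop M) \<and>
     (\<Union>i\<in>chart_idx M. chart_dom M i) = topspace (mtop M) \<and>
     (\<forall>i\<in>chart_idx M.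
        openin (mtop M) (chart_dom M i) \<and> open (chart_img M i) \<and>
        homeomorphic_map (subtopology (mtop M) (chart_dom M i))
          (top_of_set (chart_img M i)) (chart_map M i)) \<and>
     smooth_in_charts M M (\<lambda>p. p)"

definition metric_index :: "real^'n^'n \<Rightarrow> nat" where
  "metric_index A = Max {dim W |W. subspace W \<and> (\<forall>w\<in>W. w \<noteq> 0 \<longrightarrow> w \<bullet> (A *v w) < 0)}"

text \<open>The condition \<open>preserves_metric M M (\<lambda>p. p)\<close> is the transformation law of
  a covariant 2-tensor under changes of charts.\<close>

definition pseudo_riemannian :: "('a, 'i, 'n::finite) mfd \<Rightarrow> bool" where
  "pseudo_riemannian M \<longleftrightarrow>
     smooth_manifold M \<and>
     (\<forall>i\<in>chart_idx M. smooth_on (chart_img M i) (chart_metric M i)) \<and>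
     (\<forall>i\<in>chart_idx M. \<forall>x\<in>chart_img M i.
        transpose (chart_metric M i x) = chart_metric M i x \<and> invertible (chart_metric M i x)) \<and>
     (\<exists>\<nu>. \<forall>i\<in>chart_idx M. \<forall>x\<in>chart_img M i. metric_index (chart_metric M i x) = \<nu>) \<and>
     preserves_metric M M (\<lambda>p. p)"

text \<open>Christoffel symbols \<open>\<Gamma>\<^bsup>a\<^esup>\<^bsub>bc\<^esub>\<close> and components
  \<open>R\<^bsup>a\<^esup>\<^bsub>bcd\<^esub>\<close> of the curvature tensor of the Levi-Civita connection of a matrix-valued function
  \<open>g\<close> on an open subset of coordinate space.\<close>

definition pderiv_at :: "'n \<Rightarrow> (real^'n \<Rightarrow> real) \<Rightarrow> real^'n \<Rightarrow> real" where
  "pderiv_at k f x = frechet_derivative f (at x) (axis k 1)"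

definition christoffel :: "(real^'n \<Rightarrow> real^'n^'n) \<Rightarrow> 'n \<Rightarrow> 'n \<Rightarrow> 'n \<Rightarrow> real^'n \<Rightarrow> real" where
  "christoffel g a b c x =
     (1/2) * (\<Sum>m\<in>UNIV. matrix_inv (g x) $ a $ m *
       (pderiv_at b (\<lambda>y. g y $ m $ c) x + pderiv_at c (\<lambda>y. g y $ m $ b) x
        - pderiv_at m (\<lambda>y. g y $ b $ c) x))"

definition riemann_curvature ::
  "(real^'n \<Rightarrow> real^'n^'n) \<Rightarrow> 'n \<Rightarrow> 'n \<Rightarrow> 'n \<Rightarrow> 'n \<Rightarrow> real^'n \<Rightarrow> real" where
  "riemann_curvature g a b c d x =
     pderiv_at c (christoffel g a d b) x - pderiv_at d (christoffel g a c b) x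
     + (\<Sum>m\<in>UNIV. christoffel g a c m x * christoffel g m d b x
                   - christoffel g a d m x * christoffel g m c b x)"

definition flat :: "('a, 'i, 'n::finite) mfd \<Rightarrow> bool" where
  "flat M \<longleftrightarrow> (\<forall>i\<in>chart_idx M. \<forall>x\<in>chart_img M i. \<forall>a b c d.
     riemann_curvature (chart_metric M i) a b c d x = 0)"

definition smooth_map ::
  "('a, 'i, 'n::finite) mfd \<Rightarrow> ('b, 'j, 'm::finite) mfd \<Rightarrow> ('a \<Rightarrow> 'b) \<Rightarrow> bool" where
  "smooth_map M N f \<longleftrightarrow> continuous_map (mtop M) (mtop N) f \<and> smooth_in_charts M N f"

text \<open>Both manifolds have the same dimension here, so preserving a nondegenerate metric
  makes every differential a linear isometric isomorphism.\<close>

definition local_isometry ::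
  "('a, 'i, 'n::finite) mfd \<Rightarrow> ('b, 'j, 'n) mfd \<Rightarrow> ('a \<Rightarrow> 'b) \<Rightarrow> bool" where
  "local_isometry M N f \<longleftrightarrow> smooth_map M N f \<and> preserves_metric M N f"

definition isometry ::
  "('a, 'i, 'n::finite) mfd \<Rightarrow> ('b, 'j, 'n) mfd \<Rightarrow> ('a \<Rightarrow> 'b) \<Rightarrow> bool" where
  "isometry M N f \<longleftrightarrow>
     bij_betw f (topspace (mtop M)) (topspace (mtop N)) \<and>
     smooth_map M N f \<and> smooth_map N M (the_inv_into (topspace (mtop M)) f) \<and>
     preserves_metric M N f"

text \<open>The isometry group, as a subgroup of the group of all (extensional) bijections of the
  underlying set.\<close>

definition Isom :: "('a, 'i, 'n::finite) mfd \<Rightarrow> ('a \<Rightarrow> 'a) monoid" where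
  "Isom M = (BijGroup (topspace (mtop M)))
     \<lparr>carrier := {f \<in> Bij (topspace (mtop M)). isometry M M f}\<rparr>"

text \<open>The compact-open topology, which is the topology underlying the Lie group structure of the
  isometry group of a pseudo-Riemannian manifold.\<close>

definition Isom_top :: "('a, 'i, 'n::finite) mfd \<Rightarrow> ('a \<Rightarrow> 'a) topology" where
  "Isom_top M = topology_generated_by
     {{f \<in> carrier (Isom M). f ` K \<subseteq> U} |K U. compactin (mtop M) K \<and> openin (mtop M) U}"

definition homogeneous :: "('a, 'i, 'n::finite) mfd \<Rightarrow> bool" where
  "homogeneous M \<longleftrightarrow>
     (\<forall>p\<in>topspace (mtop M). \<forall>q\<in>topspace (mtop M). \<exists>f\<in>carrier (Isom M). f p = q)"

section \<open>Quotients\<close>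

definition quotient_topology :: "'a topology \<Rightarrow> ('a \<Rightarrow> 'b) \<Rightarrow> 'b topology" where
  "quotient_topology X p =
     topology (\<lambda>U. U \<subseteq> p ` topspace X \<and> openin X {x \<in> topspace X. p x \<in> U})"

lemma openin_quotient_topology:
  "openin (quotient_topology X p) U \<longleftrightarrow>
     U \<subseteq> p ` topspace X \<and> openin X {x \<in> topspace X. p x \<in> U}"
proof -
  let ?P = "\<lambda>U. U \<subseteq> p ` topspace X \<and> openin X {x \<in> topspace X. p x \<in> U}"
  have "istopology ?P"
    unfolding istopology_def
  proof (intro conjI allI impI)
    fix S T assume S: "?P S" and T: "?P T"
    show "S \<inter> T \<subseteq> p ` topspace X" using S by blast
    have "{x \<in> topspace X. p x \<in> S \<inter> T} =
        {x \<in> topspace X. p x \<in> S} \<inter> {x \<in> topspace X. p x \<in> T}" by blast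
    then show "openin X {x \<in> topspace X. p x \<in> S \<inter> T}" using S T by (simp add: openin_Int)
  next
    fix K assume K: "\<forall>S\<in>K. ?P S"
    show "\<Union>K \<subseteq> p ` topspace X" using K by blast
    have "{x \<in> topspace X. p x \<in> \<Union>K} = (\<Union>S\<in>K. {x \<in> topspace X. p x \<in> S})" by blast
    then show "openin X {x \<in> topspace X. p x \<in> \<Union>K}" using K by (auto intro!: openin_Union)
  qed
  then show ?thesis
    unfolding quotient_topology_def by (simp add: topology_inverse')
qed

text \<open>The quotient of \<open>X\<close> along \<open>p\<close>: its charts are the charts of \<open>X\<close> precomposed with
  the inverses of the restrictions of \<open>p\<close> to open sets \<open>W\<close> on which \<open>p\<close> is injective, and
  each of them carries the components of the metric of \<open>X\<close>. Whether this yields a manifold for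
  which \<open>p\<close> is a local isometry depends on \<open>p\<close>.\<close>

definition quotient_mfd ::
  "('a, 'i, 'n::finite) mfd \<Rightarrow> ('a \<Rightarrow> 'b) \<Rightarrow> ('b, 'i \<times> 'a set, 'n) mfd" where
  "quotient_mfd X p =
     \<lparr>mtop = quotient_topology (mtop X) p,
      chart_idx = {(i, W). i \<in> chart_idx X \<and> openin (mtop X) W \<and> W \<subseteq> chart_dom X i \<and> inj_on p W},
      chart_dom = (\<lambda>(i, W). p ` W),
      chart_map = (\<lambda>(i, W). chart_map X i \<circ> the_inv_into W p),
      chart_metric = (\<lambda>(i, W). chart_metric X i)\<rparr>"

section \<open>Pseudo-Euclidean space and three-vectors\<close>

text \<open>The scalar product on \<open>\<real>\<^bsup>k,l\<^esup>\<close>; \<open>K\<close> is the set of the \<open>k\<close> coordinates that contribute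
  with sign \<open>+1\<close>, the other \<open>l\<close> coordinates contribute with sign \<open>-1\<close>.\<close>

definition pinner :: "'n set \<Rightarrow> real^'n \<Rightarrow> real^'n \<Rightarrow> real" where
  "pinner K x y = (\<Sum>i\<in>UNIV. (if i \<in> K then 1 else -1) * x $ i * y $ i)"

text \<open>Three-vectors, regarded as alternating trilinear forms.\<close>

definition three_vector :: "(real^'n \<Rightarrow> real^'n \<Rightarrow> real^'n \<Rightarrow> real) \<Rightarrow> bool" where
  "three_vector \<eta> \<longleftrightarrow>
     (\<forall>Y Z. linear (\<lambda>X. \<eta> X Y Z)) \<and> (\<forall>X Z. linear (\<lambda>Y. \<eta> X Y Z)) \<and> (\<forall>X Y. linear (\<lambda>Z. \<eta> X Y Z)) \<and>
     (\<forall>X Y. \<eta> X X Y = 0 \<and> \<eta> X Y Y = 0 \<and> \<eta> X Y X = 0)"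

text \<open>\<open>\<eta> = \<Sum> c\<^bsub>ijm\<^esub> b\<^sub>i \<otimes> b\<^sub>j \<otimes> b\<^sub>m\<close> with rational \<open>c\<^bsub>ijm\<^esub>\<close> for some basis \<open>b\<close> of \<open>V\<close>, the vectors \<open>b\<^sub>i\<close>
  acting on \<open>V\<close> through the scalar product. The coefficients \<open>c\<close> are alternating since \<open>\<eta>\<close> is.\<close>

definition rational_coefficients ::
  "'n set \<Rightarrow> (real^'n \<Rightarrow> real^'n \<Rightarrow> real^'n \<Rightarrow> real) \<Rightarrow> bool" where
  "rational_coefficients K \<eta> \<longleftrightarrow>
     (\<exists>b :: 'n \<Rightarrow> real^'n. inj b \<and> independent (range b) \<and> span (range b) = UNIV \<and>
       (\<exists>c :: 'n \<Rightarrow> 'n \<Rightarrow> 'n \<Rightarrow> real. (\<forall>i j m. c i j m \<in> \<rat>) \<and>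
         (\<forall>X Y Z. \<eta> X Y Z =
           (\<Sum>i\<in>UNIV. \<Sum>j\<in>UNIV. \<Sum>m\<in>UNIV.
              c i j m * pinner K (b i) X * pinner K (b j) Y * pinner K (b m) Z))))"

definition eta_endo ::
  "'n set \<Rightarrow> (real^'n \<Rightarrow> real^'n \<Rightarrow> real^'n \<Rightarrow> real) \<Rightarrow> real^'n \<Rightarrow> real^'n \<Rightarrow> real^'n" where
  "eta_endo K \<eta> X Y = (THE W. \<forall>Z. pinner K W Z = \<eta> X Y Z)"

lemma pinner_axis: "pinner K x (axis i 1) = (if i \<in> K then 1 else -1) * x $ i"
proof -
  have "pinner K x (axis i 1) =
      (\<Sum>j\<in>UNIV. if j = i then (if i \<in> K then 1 else -1) * x $ i else 0)"
    unfolding pinner_def by (intro sum.cong) (auto simp: axis_def)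
  then show ?thesis by simp
qed

lemma eta_endo_ex1:
  assumes "three_vector \<eta>"
  shows "\<exists>!W. \<forall>Z. pinner K W Z = \<eta> X Y Z"
proof (rule ex_ex1I)
  have lin: "linear (\<lambda>Z. \<eta> X Y Z)" using assms by (simp add: three_vector_def)
  let ?W = "\<chi> i. (if i \<in> K then 1 else -1) * \<eta> X Y (axis i 1)"
  have "pinner K ?W Z = \<eta> X Y Z" for Z
  proof -
    have "\<eta> X Y Z = \<eta> X Y (\<Sum>i\<in>UNIV. Z $ i *\<^sub>R axis i 1)"
      using basis_expansion[of Z] by (simp add: scalar_mult_eq_scaleR)
    also have "\<dots> = (\<Sum>i\<in>UNIV. Z $ i * \<eta> X Y (axis i 1))"
      by (simp add: linear_sum[OF lin] linear_cmul[OF lin])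
    also have "\<dots> = pinner K ?W Z"
      unfolding pinner_def by (intro sum.cong) auto
    finally show ?thesis by simp
  qed
  then show "\<exists>W. \<forall>Z. pinner K W Z = \<eta> X Y Z" by blast
next
  fix W W' assume "\<forall>Z. pinner K W Z = \<eta> X Y Z" "\<forall>Z. pinner K W' Z = \<eta> X Y Z"
  then have eq: "pinner K W (axis i 1) = pinner K W' (axis i 1)" for i by simp
  have "W $ i = W' $ i" for i
    using eq[of i] by (cases "i \<in> K") (simp_all add: pinner_axis)
  then show "W = W'" by (simp add: vec_eq_iff)
qed

lemma pinner_eta_endo:
  "three_vector \<eta> \<Longrightarrow> pinner K (eta_endo K \<eta> X Y) Z = \<eta> X Y Z"
  unfolding eta_endo_def using theI'[OF eta_endo_ex1] by blast

definition support ::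
  "'n set \<Rightarrow> (real^'n \<Rightarrow> real^'n \<Rightarrow> real^'n \<Rightarrow> real) \<Rightarrow> (real^'n) set" where
  "support K \<eta> = span {eta_endo K \<eta> X Y |X Y. True}"

definition isotropic :: "'n set \<Rightarrow> (real^'n) set \<Rightarrow> bool" where
  "isotropic K W \<longleftrightarrow> (\<forall>v\<in>W. \<forall>w\<in>W. pinner K v w = 0)"

section \<open>The group \<open>\<L>(\<eta>)\<close>, lattices and the quotient\<close>

definition g_isom ::
  "'n set \<Rightarrow> (real^'n \<Rightarrow> real^'n \<Rightarrow> real^'n \<Rightarrow> real) \<Rightarrow> real^'n \<Rightarrow> real^'n \<Rightarrow> real^'n" where
  "g_isom K \<eta> X = (\<lambda>x. x + eta_endo K \<eta> X x + X)"

definition L_group ::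
  "'n set \<Rightarrow> (real^'n \<Rightarrow> real^'n \<Rightarrow> real^'n \<Rightarrow> real) \<Rightarrow> (real^'n \<Rightarrow> real^'n) monoid" where
  "L_group K \<eta> = \<lparr>carrier = range (g_isom K \<eta>), mult = (\<circ>), one = id\<rparr>"

text \<open>
  \<open>(\<L>(\<eta>), h)\<close>. The topology is the one induced by the topology of pointwise convergence on maps
  \<open>V \<Rightarrow> V\<close>, which on affine maps is the usual topology. The smooth structure is given by the
  orbit map \<open>g \<mapsto> g 0\<close> as a global chart; in this chart the pullback \<open>h\<close> of the scalar
  product by the orbit map has the Gram matrix of the scalar product as its components.
\<close>

definition L_mfd ::
  "'n::finite set \<Rightarrow> (real^'n \<Rightarrow> real^'n \<Rightarrow> real^'n \<Rightarrow> real) \<Rightarrow> (real^'n \<Rightarrow> real^'n, unit, 'n) mfd" where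
  "L_mfd K \<eta> =
     \<lparr>mtop = top_of_set (carrier (L_group K \<eta>)),
      chart_idx = UNIV,
      chart_dom = (\<lambda>_. carrier (L_group K \<eta>)),
      chart_map = (\<lambda>_ g. g 0),
      chart_metric = (\<lambda>_ _. \<chi> i j. pinner K (axis i 1) (axis j 1))\<rparr>"

definition coset_proj ::
  "'n set \<Rightarrow> (real^'n \<Rightarrow> real^'n \<Rightarrow> real^'n \<Rightarrow> real) \<Rightarrow> (real^'n \<Rightarrow> real^'n) set \<Rightarrow>
     (real^'n \<Rightarrow> real^'n) \<Rightarrow> (real^'n \<Rightarrow> real^'n) set" where
  "coset_proj K \<eta> \<Gamma> x = \<Gamma> #>\<^bsub>L_group K \<eta>\<^esub> x"

definition lattice_in_L ::
  "'n::finite set \<Rightarrow> (real^'n \<Rightarrow> real^'n \<Rightarrow> real^'n \<Rightarrow> real) \<Rightarrow> (real^'n \<Rightarrow> real^'n) set \<Rightarrow> bool" where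
  "lattice_in_L K \<eta> \<Gamma> \<longleftrightarrow>
     subgroup \<Gamma> (L_group K \<eta>) \<and>
     subtopology (mtop (L_mfd K \<eta>)) \<Gamma> = discrete_topology \<Gamma> \<and>
     compact_space (quotient_topology (mtop (L_mfd K \<eta>)) (coset_proj K \<eta> \<Gamma>))"

definition M_mfd ::
  "'n::finite set \<Rightarrow> (real^'n \<Rightarrow> real^'n \<Rightarrow> real^'n \<Rightarrow> real) \<Rightarrow> (real^'n \<Rightarrow> real^'n) set \<Rightarrow>
     ((real^'n \<Rightarrow> real^'n) set, unit \<times> (real^'n \<Rightarrow> real^'n) set, 'n) mfd" where
  "M_mfd K \<eta> \<Gamma> = quotient_mfd (L_mfd K \<eta>) (coset_proj K \<eta> \<Gamma>)"

text \<open>\<open>\<pi>(g)(\<Gamma>x) = \<Gamma>xg\<^bsup>-1\<^esup>\<close>, the set \<open>\<Gamma>x\<close> being multiplied elementwise.\<close>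

definition pi_hom ::
  "'n set \<Rightarrow> (real^'n \<Rightarrow> real^'n \<Rightarrow> real^'n \<Rightarrow> real) \<Rightarrow> (real^'n \<Rightarrow> real^'n) set \<Rightarrow>
     (real^'n \<Rightarrow> real^'n) \<Rightarrow> (real^'n \<Rightarrow> real^'n) set \<Rightarrow> (real^'n \<Rightarrow> real^'n) set" where
  "pi_hom K \<eta> \<Gamma> g =
     (\<lambda>p \<in> rcosets\<^bsub>L_group K \<eta>\<^esub> \<Gamma>. p #>\<^bsub>L_group K \<eta>\<^esub> (inv\<^bsub>L_group K \<eta>\<^esub> g))"

end

theory Submission
  imports Defs
begin

text \<open>
  Since the support of \<open>\<eta>\<close> is isotropic, \<open>\<eta>\<^sub>X \<eta>\<^sub>Y = 0\<close>, and the orbit map identifies \<open>\<L>(\<eta>)\<close> with \<open>V\<close>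
  carrying the product \<open>X \<star> Y = X + Y + \<eta>\<^sub>X Y\<close>, whose left and right translations are affine
  isometries of \<open>V\<close>. For a lattice \<open>\<Lambda> \<subseteq> (V, \<star>)\<close> the projection \<open>V \<rightarrow> M\<close> is a local isometry, and right
  translations descend to \<open>M\<close>.

  The image of \<open>\<pi>\<close> is connected, so it is the identity component as soon as it is open and closed.
  Both follow from this: an isometry \<open>h\<close> of \<open>M\<close> that is uniformly close to some \<open>\<pi>(g)\<close> lifts
  uniquely to a map \<open>F\<close> of \<open>V\<close> close to the corresponding right translation; uniqueness makes \<open>F\<close>
  continuous and \<open>\<Lambda>\<close>-equivariant; a \<open>C\<^sup>2\<close> isometry of a pseudo-Euclidean space is affine; and as \<open>\<Lambda>\<close> spans \<open>V\<close> by
  compactness of \<open>M\<close>, an equivariant affine map is a right translation.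

  If \<open>\<eta>\<close> has rational coefficients in a basis \<open>b\<close>, let \<open>e\<close> be the dual basis and complete a basis \<open>T\<close> of the
  support, chosen among the vectors \<open>\<eta>\<^sub>X Y\<close> with \<open>X, Y\<close> in \<open>e\<close>, to a basis of \<open>V\<close> by vectors in \<open>e\<close>. The
  vectors with integral coordinates outside \<open>T\<close> whose component in the support has coefficients
  with a fixed common denominator in the basis \<open>b\<close> form a lattice.
\<close>

section \<open>Isometries of pseudo-Euclidean space\<close>

lemma Ck_on_subset: "Ck_on k S f \<Longrightarrow> T \<subseteq> S \<Longrightarrow> Ck_on k T f"
  by (induction k arbitrary: f) (auto intro: continuous_on_subset)

text \<open>On an open set equal functions have equal derivatives, which carries the induction to
  the next order.\<close>

lemma Ck_on_cong:
  assumes "open S" "Ck_on k S f" "\<And>x. x \<in> S \<Longrightarrow> f x = g x"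
  shows "Ck_on k S g"
  using assms(2,3)
proof (induction k arbitrary: f g)
  case 0
  then show ?case by (simp cong: continuous_on_cong)
next
  case (Suc k)
  have diff: "f differentiable (at x)" if "x \<in> S" for x using Suc.prems that by simp
  have g: "g differentiable (at x)" if "x \<in> S" for x
    using diff[OF that] Suc.prems(2) unfolding differentiable_def
    by (meson assms(1) has_derivative_transform_within_open that)
  have "frechet_derivative f (at x) = frechet_derivative g (at x)" if "x \<in> S" for x
    by (rule frechet_derivative_transform_within_open[OF diff[OF that] assms(1) that]) (use Suc.prems(2) in auto)
  then have "Ck_on k S (\<lambda>x. frechet_derivative g (at x) v)" for v
    using Suc.IH[of "\<lambda>x. frechet_derivative f (at x) v" "\<lambda>x. frechet_derivative g (at x) v"] Suc.prems(1)
    by simp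
  then show ?case using g by simp
qed

text \<open>Derivatives are taken along the full filter \<open>at x\<close>, so every level of the
  recursion is inherited from a neighbourhood of each point.\<close>

lemma Ck_on_local:
  assumes "\<And>x. x \<in> S \<Longrightarrow> \<exists>U. open U \<and> x \<in> U \<and> Ck_on k U f"
  shows "Ck_on k S f"
  using assms
proof (induction k arbitrary: f)
  case 0
  have "isCont f x" if "x \<in> S" for x
    using "0"[OF that] continuous_on_eq_continuous_at by auto
  then show ?case by (simp add: continuous_at_imp_continuous_on)
next
  case (Suc k)
  have "f differentiable (at x)" if "x \<in> S" for x using Suc.prems[OF that] by auto
  moreover have "Ck_on k S (\<lambda>x. frechet_derivative f (at x) v)" for v
    by (rule Suc.IH) (use Suc.prems in fastforce)
  ultimately show ?case by simp
qed

lemma Ck_on_const: "Ck_on k S (\<lambda>_. c)"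
  by (induction k arbitrary: c) simp_all

lemma smooth_on_const: "smooth_on S (\<lambda>_. c)"
  by (simp add: smooth_on_def Ck_on_const)

lemma frechet_derivative_affine:
  assumes "bounded_linear A"
  shows "frechet_derivative (\<lambda>x. A x + b) (at x) = A"
proof -
  have "((\<lambda>x. A x + b) has_derivative A) (at x)"
    using bounded_linear.has_derivative[OF assms has_derivative_ident, of "at x"]
    by (auto intro: derivative_eq_intros)
  from frechet_derivative_at[OF this] show ?thesis by simp
qed

lemma smooth_on_affine:
  assumes "bounded_linear A"
  shows "smooth_on S (\<lambda>x. A x + b)"
  unfolding smooth_on_def
proof
  fix k show "Ck_on k S (\<lambda>x. A x + b)"
  proof (cases k)
    case 0 then show ?thesis
      using continuous_on_add[OF linear_continuous_on[OF assms] continuous_on_const] by simp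
  next
    case (Suc j)
    have "((\<lambda>x. A x + b) has_derivative A) (at x)" for x
      using bounded_linear.has_derivative[OF assms has_derivative_ident, of "at x"]
      by (auto intro: derivative_eq_intros)
    then have "(\<lambda>x. A x + b) differentiable (at x)" for x using differentiableI by blast
    then show ?thesis using Suc by (simp add: frechet_derivative_affine[OF assms] Ck_on_const)
  qed
qed

section \<open>Symmetry of second derivatives\<close>

text \<open>The mean value theorem is applied twice: to the increment along \<open>w\<close> as a
  function of the step along \<open>v\<close>, then to \<open>D v\<close> along \<open>w\<close>.
  The left side is symmetric in \<open>v\<close> and \<open>w\<close>.\<close>

lemma double_difference_mean_value:
  fixes f :: "'a::real_normed_vector \<Rightarrow> real"
  assumes f: "\<And>x. (f has_derivative (\<lambda>v. D v x)) (at x)"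
    and D: "\<And>x. (D v has_derivative (\<lambda>w. D2 w x)) (at x)"
    and h: "0 < h"
  shows "\<exists>s t. 0 < s \<and> s < h \<and> 0 < t \<and> t < h \<and>
    f (x + h *\<^sub>R v + h *\<^sub>R w) - f (x + h *\<^sub>R v) - f (x + h *\<^sub>R w) + f x
     = h * h * D2 w (x + s *\<^sub>R v + t *\<^sub>R w)"
proof -
  let ?g = "\<lambda>s. f (x + s *\<^sub>R v + h *\<^sub>R w) - f (x + s *\<^sub>R v)"
  have scale: "D (c *\<^sub>R u) y = c * D u y" for c u y
    using linear_cmul[OF has_derivative_linear[OF f]] by simp
  have scale2: "D2 (c *\<^sub>R u) y = c * D2 u y" for c u y
    using linear_cmul[OF has_derivative_linear[OF D]] by simp
  have dg: "(?g has_real_derivative (D v (x + s *\<^sub>R v + h *\<^sub>R w) - D v (x + s *\<^sub>R v))) (at s)" for s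
    unfolding has_field_derivative_def
    by (rule has_derivative_eq_rhs, (rule derivative_intros has_derivative_compose[OF _ f])+)
       (auto simp: scale algebra_simps)
  obtain s where s: "0 < s" "s < h"
    "?g h - ?g 0 = (h - 0) * (D v (x + s *\<^sub>R v + h *\<^sub>R w) - D v (x + s *\<^sub>R v))"
    using MVT2[OF h, of ?g "\<lambda>s. D v (x + s *\<^sub>R v + h *\<^sub>R w) - D v (x + s *\<^sub>R v)"] dg by blast
  let ?k = "\<lambda>t. D v (x + s *\<^sub>R v + t *\<^sub>R w)"
  have dk: "(?k has_real_derivative (D2 w (x + s *\<^sub>R v + t *\<^sub>R w))) (at t)" for t
    unfolding has_field_derivative_def
    by (rule has_derivative_eq_rhs, (rule derivative_intros has_derivative_compose[OF _ D])+)
       (auto simp: scale2 algebra_simps)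
  obtain t where t: "0 < t" "t < h" "?k h - ?k 0 = (h - 0) * D2 w (x + s *\<^sub>R v + t *\<^sub>R w)"
    using MVT2[OF h, of ?k "\<lambda>t. D2 w (x + s *\<^sub>R v + t *\<^sub>R w)"] dk by blast
  have "f (x + h *\<^sub>R v + h *\<^sub>R w) - f (x + h *\<^sub>R v) - f (x + h *\<^sub>R w) + f x
     = h * h * D2 w (x + s *\<^sub>R v + t *\<^sub>R w)"
    using s(3) t(3) by (simp add: algebra_simps)
  then show ?thesis using s t by blast
qed

text \<open>The symmetric second difference gives points arbitrarily close to \<open>x\<close> where
  a value of \<open>D2 v w\<close> equals a value of \<open>D2 w v\<close>; continuity moves the
  equality to \<open>x\<close>.\<close>

lemma second_derivative_symmetric_real:
  fixes f :: "'a::real_normed_vector \<Rightarrow> real"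
  assumes f: "\<And>x. (f has_derivative (\<lambda>v. D v x)) (at x)"
    and D: "\<And>x v. (D v has_derivative (\<lambda>w. D2 v w x)) (at x)"
    and cont: "\<And>v w. continuous_on UNIV (D2 v w)"
  shows "D2 v w x = D2 w v x"
proof (rule ccontr)
  assume ne: "D2 v w x \<noteq> D2 w v x"
  define e where "e = dist (D2 v w x) (D2 w v x) / 2"
  have e: "e > 0" using ne by (simp add: e_def)
  obtain d1 where d1: "d1 > 0" "\<And>y. dist y x < d1 \<Longrightarrow> dist (D2 v w y) (D2 v w x) < e"
    using cont[of v w] e unfolding continuous_on_iff by blast
  obtain d2 where d2: "d2 > 0" "\<And>y. dist y x < d2 \<Longrightarrow> dist (D2 w v y) (D2 w v x) < e"
    using cont[of w v] e unfolding continuous_on_iff by blast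
  \<comment> \<open>All points \<open>x + s v + t w\<close> with \<open>0 < s, t < h\<close> lie
    within \<open>min d1 d2\<close> of \<open>x\<close>; the summand 1 keeps the denominator
    positive.\<close>
  define h where "h = min d1 d2 / (norm v + norm w + 1)"
  have pos: "norm v + norm w + 1 > 0" by (simp add: add_nonneg_pos)
  have h: "h > 0" using d1 d2 pos by (simp add: h_def)
  have small: "dist (x + s *\<^sub>R v + t *\<^sub>R w) x < min d1 d2" if "0 < s" "s < h" "0 < t" "t < h" for s t
  proof -
    have "norm (s *\<^sub>R v + t *\<^sub>R w) \<le> s * norm v + t * norm w"
      by (rule order_trans[OF norm_triangle_ineq]) (use that in simp)
    also have "\<dots> \<le> h * norm v + h * norm w"
      using that by (intro add_mono mult_right_mono) auto
    also have "\<dots> < h * (norm v + norm w + 1)" using h by (simp add: algebra_simps)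
    also have "\<dots> = min d1 d2" using pos by (simp add: h_def)
    finally show ?thesis by (simp add: dist_norm add.assoc)
  qed
  obtain s t where 1: "0 < s" "s < h" "0 < t" "t < h"
     "f (x + h *\<^sub>R v + h *\<^sub>R w) - f (x + h *\<^sub>R v) - f (x + h *\<^sub>R w) + f x
       = h * h * D2 v w (x + s *\<^sub>R v + t *\<^sub>R w)"
    using double_difference_mean_value[OF f D h] by blast
  obtain s' t' where 2: "0 < s'" "s' < h" "0 < t'" "t' < h"
     "f (x + h *\<^sub>R w + h *\<^sub>R v) - f (x + h *\<^sub>R w) - f (x + h *\<^sub>R v) + f x
       = h * h * D2 w v (x + s' *\<^sub>R w + t' *\<^sub>R v)"
    using double_difference_mean_value[OF f D h] by blast
  have "h * h * D2 v w (x + s *\<^sub>R v + t *\<^sub>R w) = h * h * D2 w v (x + s' *\<^sub>R w + t' *\<^sub>R v)"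
    using 1(5) 2(5) by (simp add: algebra_simps)
  then have eq: "D2 v w (x + s *\<^sub>R v + t *\<^sub>R w) = D2 w v (x + t' *\<^sub>R v + s' *\<^sub>R w)"
    using h by (simp add: algebra_simps)
  have "dist (D2 v w (x + s *\<^sub>R v + t *\<^sub>R w)) (D2 v w x) < e"
    using d1(2) small[of s t] 1 by simp
  moreover have "dist (D2 w v (x + t' *\<^sub>R v + s' *\<^sub>R w)) (D2 w v x) < e"
    using d2(2) small[of t' s'] 2 by simp
  ultimately have "dist (D2 v w x) (D2 w v x) < e + e"
    using eq by (metis dist_triangle_less_add dist_commute)
  then show False by (simp add: e_def)
qed

lemma second_derivative_symmetric:
  fixes f :: "'a::real_normed_vector \<Rightarrow> 'b::euclidean_space"
  assumes f: "\<And>x. (f has_derivative (\<lambda>v. D v x)) (at x)"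
    and D: "\<And>x v. (D v has_derivative (\<lambda>w. D2 v w x)) (at x)"
    and cont: "\<And>v w. continuous_on UNIV (D2 v w)"
  shows "D2 v w x = D2 w v x"
proof (rule euclidean_eqI)
  fix i :: 'b assume "i \<in> Basis"
  show "D2 v w x \<bullet> i = D2 w v x \<bullet> i"
    by (rule second_derivative_symmetric_real[of "\<lambda>x. f x \<bullet> i" "\<lambda>v x. D v x \<bullet> i" "\<lambda>v w x. D2 v w x \<bullet> i"])
       (auto intro!: has_derivative_inner_left f D continuous_intros cont)
qed

section \<open>The scalar product, its Gram matrix and linear isometries\<close>

lemma pinner_alt: "pinner K x y = (\<chi> i. (if i \<in> K then 1 else -1) * x $ i) \<bullet> y"
  by (simp add: pinner_def inner_vec_def)

lemma pinner_commute: "pinner K x y = pinner K y x"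
  by (simp add: pinner_def mult_ac)

lemma linear_pinner_right: "linear (pinner K x)"
  unfolding pinner_alt by (rule bounded_linear.linear[OF bounded_linear_inner_right])

lemma linear_pinner_left: "linear (\<lambda>x. pinner K x y)"
  using linear_pinner_right[of K y] by (subst pinner_commute)

lemma bounded_bilinear_pinner: "bounded_bilinear (pinner (K :: 'n::finite set))"
  using linear_pinner_right[of K] linear_pinner_left[of K]
  by (simp add: bilinear_conv_bounded_bilinear[symmetric] bilinear_def eta_contract_eq)

lemmas pinner_add_left = linear_add[OF linear_pinner_left]
  and pinner_add_right = linear_add[OF linear_pinner_right]
  and pinner_scale_left = linear_cmul[OF linear_pinner_left]
  and pinner_scale_right = linear_cmul[OF linear_pinner_right]
  and pinner_diff_left = linear_diff[OF linear_pinner_left]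
  and pinner_zero_right [simp] = linear_0[OF linear_pinner_right]
  and pinner_zero_left [simp] = linear_0[OF linear_pinner_left]
  and pinner_sum_right = linear_sum[OF linear_pinner_right]

lemma pinner_nondegenerate:
  assumes "\<And>z. pinner K x z = 0"
  shows "x = 0"
proof -
  have "x $ i = 0" for i
    using assms[of "axis i 1"] by (simp add: pinner_axis split: if_splits)
  then show ?thesis by (simp add: vec_eq_iff)
qed

text \<open>The constant metric matrix in the charts of \<open>L_mfd\<close> and
  \<open>M_mfd\<close>: diagonal, with entries 1 on \<open>K\<close> and -1 elsewhere.\<close>

definition gram :: "'n::finite set \<Rightarrow> real^'n^'n" where
  "gram K = (\<chi> i j. pinner K (axis i 1) (axis j 1))"

lemma gram_vec: "gram K *v w = (\<chi> i. (if i \<in> K then 1 else -1) * w $ i)"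
proof -
  have "(\<Sum>j\<in>UNIV. pinner K (axis i 1) (axis j 1) * w $ j) = (if i \<in> K then 1 else -1) * w $ i" for i
  proof -
    have "(\<Sum>j\<in>UNIV. pinner K (axis i 1) (axis j 1) * w $ j)
      = (\<Sum>j\<in>UNIV. if j = i then (if i \<in> K then 1 else -1) * w $ i else 0)"
      by (intro sum.cong refl) (simp add: pinner_axis, simp add: axis_def)
    then show ?thesis by simp
  qed
  then show ?thesis by (simp add: gram_def matrix_vector_mult_def vec_eq_iff)
qed

lemma inner_gram: "v \<bullet> (gram K *v w) = pinner K v w"
  by (simp add: gram_vec pinner_def inner_vec_def mult_ac)

lemma matrix_eq_bilinear:
  fixes A B :: "real^'n^'n"
  assumes "\<And>v w. v \<bullet> (A *v w) = v \<bullet> (B *v w)"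
  shows "A = B"
  by (metis assms matrix_eq vector_eq_ldot)

lemma transpose_gram: "transpose (gram K) = gram K"
  by (simp add: gram_def transpose_def pinner_commute)

lemma invertible_gram: "invertible (gram K)"
proof -
  have "gram K ** gram K = mat 1"
  proof (rule matrix_eq_bilinear)
    fix v w :: "real^'a"
    show "v \<bullet> (gram K ** gram K *v w) = v \<bullet> (mat 1 *v w)"
      unfolding matrix_vector_mul_assoc[symmetric] by (auto simp: gram_vec inner_vec_def intro!: sum.cong)
  qed
  then show ?thesis unfolding invertible_def by blast
qed

text \<open>Translates \<open>preserves_metric\<close>, phrased with Jacobian matrices, into
  preservation of the scalar product by the differential; a matrix is determined by its bilinear
  form.\<close>

lemma gram_pullback_iff:
  "gram K = transpose D ** gram K ** D \<longleftrightarrow> (\<forall>v w. pinner K (D *v v) (D *v w) = pinner K v w)"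
proof -
  have *: "v \<bullet> (transpose D ** gram K ** D *v w) = pinner K (D *v v) (D *v w)" for v w
    unfolding matrix_vector_mul_assoc[symmetric] inner_gram[symmetric]
    by (metis dot_lmul_matrix inner_commute transpose_matrix_vector)
  show ?thesis
    by (metis * inner_gram matrix_eq_bilinear)
qed

definition linear_isometry :: "'n::finite set \<Rightarrow> (real^'n \<Rightarrow> real^'n) \<Rightarrow> bool" where
  "linear_isometry K A \<longleftrightarrow> linear A \<and> (\<forall>v w. pinner K (A v) (A w) = pinner K v w)"

text \<open>If \<open>A v = 0\<close>, then \<open>pinner K v w = pinner K (A v) (A w) = 0\<close>
  for all \<open>w\<close>, and nondegeneracy gives \<open>v = 0\<close>.\<close>

lemma linear_isometry_inj: "linear_isometry K A \<Longrightarrow> inj A"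
  unfolding linear_isometry_def
  by (metis linear_injective_0 pinner_nondegenerate pinner_zero_left)

lemma linear_isometry_surj: "linear_isometry K A \<Longrightarrow> surj A"
  using linear_isometry_inj linear_injective_imp_surjective linear_isometry_def by blast

text \<open>The expression \<open>\<langle>D\<^sup>2F(v,u), DF w\<rangle>\<close> is symmetric in \<open>v, u\<close> and skew in \<open>v, w\<close>, hence zero.\<close>

lemma C2_isometry_affine:
  fixes F :: "real^'n \<Rightarrow> real^'n::finite"
  assumes C2: "Ck_on 2 UNIV F"
    and iso: "\<And>x. linear_isometry K (frechet_derivative F (at x))"
  shows "\<exists>A b. linear_isometry K A \<and> F = (\<lambda>x. A x + b)"
proof -
  define D where "D = (\<lambda>v x. frechet_derivative F (at x) v)"
  define D2 where "D2 = (\<lambda>v w x. frechet_derivative (D v) (at x) w)"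
  have C2': "Ck_on (Suc (Suc 0)) UNIV F" using C2 by (simp add: numeral_2_eq_2)
  have F: "(F has_derivative (\<lambda>v. D v x)) (at x)" for x
    using C2' unfolding D_def by (simp add: frechet_derivative_works)
  have D: "(D v has_derivative (\<lambda>w. D2 v w x)) (at x)" for x v
    using C2' unfolding D_def D2_def by (simp add: frechet_derivative_works)
  have cont: "continuous_on UNIV (D2 v w)" for v w
    using C2' unfolding D_def D2_def by simp
  have sym: "D2 v w x = D2 w v x" for v w x
    by (rule second_derivative_symmetric[OF F D cont])
  have pres: "pinner K (D v x) (D w x) = pinner K v w" for v w x
    using iso unfolding D_def linear_isometry_def by blast
  \<comment> \<open>Derivative in direction \<open>u\<close> of the constant function
    \<open>pinner K (D v x) (D w x)\<close>.\<close>
  have skew: "pinner K (D2 v u x) (D w x) + pinner K (D v x) (D2 w u x) = 0" for v w u x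
  proof -
    have "((\<lambda>x. pinner K (D v x) (D w x)) has_derivative
        (\<lambda>u. pinner K (D v x) (D2 w u x) + pinner K (D2 v u x) (D w x))) (at x)"
      by (rule bounded_bilinear.FDERIV[OF bounded_bilinear_pinner D D])
    moreover have "((\<lambda>x. pinner K (D v x) (D w x)) has_derivative (\<lambda>u. 0)) (at x)"
      unfolding pres by simp
    ultimately have "(\<lambda>u. pinner K (D v x) (D2 w u x) + pinner K (D2 v u x) (D w x)) = (\<lambda>u. 0)"
      by (rule has_derivative_unique)
    then show ?thesis by (metis add.commute)
  qed
  \<comment> \<open>Three uses of each symmetry bring the arguments back to their places with sign
    -1.\<close>
  have zero: "pinner K (D2 v u x) (D w x) = 0" for v u w x
    using skew[of v u x w] skew[of u w x v] skew[of w v x u] sym[of v u x] sym[of u w x] sym[of w v x]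
    by (simp add: pinner_commute)
  have "D2 v u x = 0" for v u x
  proof (rule pinner_nondegenerate)
    fix z
    obtain w where "z = D w x" using linear_isometry_surj[OF iso[of x]] unfolding D_def by (metis surjD)
    then show "pinner K (D2 v u x) z = 0" using zero by simp
  qed
  then have D0: "(D v has_derivative (\<lambda>w. 0)) (at x)" for v x using D[of v x] by simp
  have Dc: "D v x = D v 0" for v x
  proof -
    obtain c where "\<And>x. D v x = c" using has_derivative_zero_constant[of UNIV "D v"] D0 by auto
    then show ?thesis by simp
  qed
  define A where "A = (\<lambda>v. D v 0)"
  have A: "linear_isometry K A" using iso[of 0] unfolding A_def D_def .
  have "((\<lambda>x. F x - A x) has_derivative (\<lambda>v. 0)) (at x)" for x
  proof -
    have "(A has_derivative A) (at x)"
      using A by (simp add: linear_isometry_def linear_conv_bounded_linear bounded_linear_imp_has_derivative)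
    from has_derivative_diff[OF F[of x] this] show ?thesis by (simp add: Dc[of _ x] A_def)
  qed
  then obtain b where b: "\<And>x. F x - A x = b"
    using has_derivative_zero_constant[of UNIV "\<lambda>x. F x - A x"] by auto
  have "F x = A x + b" for x using b[of x] by (metis add.commute diff_add_cancel)
  then have "F = (\<lambda>x. A x + b)" by blast
  then show ?thesis using A by blast
qed

section \<open>The group structure on \<open>V\<close>\<close>

locale isotropic_three_vector =
  fixes K :: "'n::finite set" and \<eta> :: "real^'n \<Rightarrow> real^'n \<Rightarrow> real^'n \<Rightarrow> real"
  assumes three_vector: "three_vector \<eta>" and isotropic_support: "isotropic K (support K \<eta>)"
begin

abbreviation E :: "real^'n \<Rightarrow> real^'n \<Rightarrow> real^'n" where "E \<equiv> eta_endo K \<eta>"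
abbreviation G :: "real^'n \<Rightarrow> real^'n \<Rightarrow> real^'n" where "G \<equiv> g_isom K \<eta>"
abbreviation L :: "(real^'n \<Rightarrow> real^'n) monoid" where "L \<equiv> L_group K \<eta>"

section \<open>The endomorphisms \<open>E X\<close> and the product \<open>\<star>\<close> on
  \<open>V\<close>\<close>

lemma pinner_E: "pinner K (E X Y) Z = \<eta> X Y Z"
  by (rule pinner_eta_endo[OF three_vector])

lemma pinner_eqI:
  assumes "\<And>Z. pinner K W Z = pinner K W' Z" shows "W = W'"
proof -
  have "pinner K (W - W') Z = 0" for Z using assms by (simp add: pinner_diff_left)
  then show ?thesis using pinner_nondegenerate by fastforce
qed

lemma eta_linear: "linear (\<lambda>X. \<eta> X Y Z)" "linear (\<lambda>Y. \<eta> X Y Z)" "linear (\<lambda>Z. \<eta> X Y Z)"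
  using three_vector by (simp_all add: three_vector_def)

lemma linear_E_left: "linear (\<lambda>X. E X Y)"
  by (rule linearI; rule pinner_eqI)
     (simp_all add: pinner_E pinner_add_left pinner_scale_left linear_add[OF eta_linear(1)] linear_cmul[OF eta_linear(1)])

lemma linear_E_right: "linear (E X)"
  by (rule linearI; rule pinner_eqI)
     (simp_all add: pinner_E pinner_add_left pinner_scale_left linear_add[OF eta_linear(2)] linear_cmul[OF eta_linear(2)])

lemma bounded_bilinear_E: "bounded_bilinear E"
  using linear_E_left linear_E_right by (simp add: bilinear_conv_bounded_bilinear[symmetric] bilinear_def)

sublocale E: bounded_bilinear E by (rule bounded_bilinear_E)

lemma E_self [simp]: "E X X = 0"
  using three_vector by (intro pinner_eqI) (simp add: pinner_E three_vector_def)

lemma E_skew: "E X Y = - E Y X"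
proof -
  have "E (X + Y) (X + Y) = 0" by simp
  then show ?thesis by (simp only: E.add_left E.add_right) (simp add: eq_neg_iff_add_eq_0 add.commute)
qed

text \<open>\<open>E X\<close> lies in so(V): polarize \<open>\<eta> X Y Y = 0\<close>.\<close>

lemma E_skew_pinner: "pinner K (E X Y) Z = - pinner K Y (E X Z)"
proof -
  have "\<eta> X (Y + Z) (Y + Z) = 0" using three_vector by (simp add: three_vector_def)
  moreover have "\<eta> X Y Y = 0" "\<eta> X Z Z = 0" using three_vector by (simp_all add: three_vector_def)
  ultimately have "\<eta> X Y Z = - \<eta> X Z Y"
    by (simp add: linear_add[OF eta_linear(2)] linear_add[OF eta_linear(3)])
  then show ?thesis by (simp add: pinner_E pinner_commute[of K Y])
qed

lemma E_in_support: "E X Y \<in> support K \<eta>"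
  unfolding support_def by (rule span_base) blast

text \<open>The use of isotropy: moving \<open>E X\<close> across the scalar product leaves a
  pairing of \<open>E Y Z\<close> with \<open>E X U\<close>, two vectors of the support. All values
  of \<open>E\<close> are therefore central for \<open>\<star>\<close>.\<close>

lemma E_E_right [simp]: "E X (E Y Z) = 0"
proof (rule pinner_eqI)
  fix U
  have "pinner K (E Y Z) (E X U) = 0"
    using isotropic_support E_in_support unfolding isotropic_def by blast
  then show "pinner K (E X (E Y Z)) U = pinner K 0 U" by (simp add: E_skew_pinner)
qed

lemma E_E_left [simp]: "E (E X Y) Z = 0"
  using E_skew[of "E X Y" Z] by simp

lemma E_support_right: "s \<in> support K \<eta> \<Longrightarrow> E X s = 0"
  unfolding support_def by (induction rule: span_induct_alt) (auto simp: E.add_right E.scaleR_right E.zero_right)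

lemma E_support_left: "s \<in> support K \<eta> \<Longrightarrow> E s X = 0"
  using E_support_right[of s X] E_skew[of s X] by simp

text \<open>The multiplication of \<open>L\<close> read in the orbit chart, as \<open>G_comp\<close>
  makes precise. The inverse of \<open>X\<close> is \<open>- X\<close> because
  \<open>E X X = 0\<close>.\<close>

definition star :: "real^'n \<Rightarrow> real^'n \<Rightarrow> real^'n" (infixl "\<star>" 70) where
  "X \<star> Y = X + Y + E X Y"

lemma star_assoc: "X \<star> Y \<star> Z = X \<star> (Y \<star> Z)"
  by (simp add: star_def E.add_left E.add_right)

lemma star_0 [simp]: "0 \<star> X = X" "X \<star> 0 = X"
  by (simp_all add: star_def E.zero_left E.zero_right)

lemma star_minus [simp]: "(- X) \<star> X = 0" "X \<star> (- X) = 0"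
  by (simp_all add: star_def E.minus_left E.minus_right)

lemma star_cancel [simp]: "(- X) \<star> (X \<star> Y) = Y" "X \<star> (- X \<star> Y) = Y"
  by (simp_all add: star_assoc[symmetric])

lemma star_cancel_right [simp]: "Y \<star> X \<star> - X = Y" "Y \<star> - X \<star> X = Y"
  by (simp_all add: star_assoc)

lemma star_left_cancel: "X \<star> Y = X \<star> Z \<longleftrightarrow> Y = Z"
  by (metis star_cancel(1))

lemma minus_star: "- (X \<star> Y) = (- Y) \<star> (- X)"
  using E_skew[of X Y] by (simp add: star_def E.minus_left E.minus_right)

lemma continuous_on_star [continuous_intros]:
  assumes "continuous_on S f" "continuous_on S g"
  shows "continuous_on S (\<lambda>x. f x \<star> g x)"
  unfolding star_def by (intro continuous_intros assms E.continuous_on)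

lemma star_conjugate: "- X \<star> Y \<star> X = Y + 2 *\<^sub>R E Y X"
  using E_skew[of X Y] by (simp add: star_def E.add_left E.diff_left E.minus_left E.minus_right scaleR_2)

lemma G_0 [simp]: "G X 0 = X"
  by (simp add: g_isom_def E.zero_right)

lemma G_comp: "G X \<circ> G Y = G (X \<star> Y)"
  by (rule ext) (simp add: g_isom_def star_def E.add_left E.add_right)

lemma G_eq_iff [simp]: "G X = G Y \<longleftrightarrow> X = Y"
  by (metis G_0)

lemma G_zero: "G 0 = id"
  by (rule ext) (simp add: g_isom_def E.zero_left)

lemma carrier_L: "carrier L = range G"
  by (simp add: L_group_def)

lemma L_mult [simp]: "f \<otimes>\<^bsub>L\<^esub> g = f \<circ> g"
  by (simp add: L_group_def)

lemma L_one [simp]: "\<one>\<^bsub>L\<^esub> = G 0"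
  by (simp add: L_group_def G_zero)

lemma group_L: "group L"
proof (rule groupI)
  fix x assume "x \<in> carrier L"
  then obtain X where "x = G X" by (auto simp: carrier_L)
  then show "\<exists>y\<in>carrier L. y \<otimes>\<^bsub>L\<^esub> x = \<one>\<^bsub>L\<^esub>"
    by (intro bexI[of _ "G (- X)"]) (simp_all add: carrier_L G_comp)
qed (auto simp: carrier_L G_comp star_assoc)

lemma L_inv: "inv\<^bsub>L\<^esub> (G X) = G (- X)"
  by (rule group.inv_equality[OF group_L]) (simp_all add: carrier_L G_comp)

text \<open>The target carries the topology of pointwise convergence, and for each fixed point the
  value is affine in \<open>X\<close>.\<close>

lemma continuous_on_G: "continuous_on UNIV G"
  unfolding g_isom_def
  by (intro continuous_on_coordinatewise_then_product continuous_intros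
      bounded_linear.continuous_on[OF E.bounded_linear_left])

text \<open>The inverse is evaluation at \<open>0\<close>, a coordinate projection of the product
  topology.\<close>

lemma G_homeomorphism: "homeomorphism UNIV (range G) G (\<lambda>g. g 0)"
  by (rule homeomorphismI)
     (auto intro!: continuous_on_G continuous_on_subset[OF continuous_on_product_coordinates])

end

section \<open>Discrete subgroups and the quotient manifold\<close>

locale discrete_subgroup_L = isotropic_three_vector K \<eta>
  for K :: "'n::finite set" and \<eta> +
  fixes \<Gamma> :: "(real^'n \<Rightarrow> real^'n) set"
  assumes subgroup: "subgroup \<Gamma> (L_group K \<eta>)"
    and discrete: "subtopology (mtop (L_mfd K \<eta>)) \<Gamma> = discrete_topology \<Gamma>"
begin

text \<open>The subgroup transported to \<open>V\<close> by the orbit chart; it is a subgroup for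
  \<open>\<star>\<close>.\<close>

definition \<Lambda> :: "(real^'n) set" where "\<Lambda> = {X. G X \<in> \<Gamma>}"

text \<open>The projection onto the quotient precomposed with \<open>G\<close>, so that
  \<open>M\<close> is handled as a quotient of the vector space \<open>V\<close>.\<close>

definition q :: "real^'n \<Rightarrow> (real^'n \<Rightarrow> real^'n) set" where "q x = coset_proj K \<eta> \<Gamma> (G x)"

lemma \<Gamma>_eq: "\<Gamma> = G ` \<Lambda>"
  using subgroup.subset[OF subgroup] by (auto simp: \<Lambda>_def carrier_L)

lemma \<Lambda>_0: "0 \<in> \<Lambda>"
  using subgroup.one_closed[OF subgroup] by (simp add: \<Lambda>_def)

lemma \<Lambda>_star: "x \<in> \<Lambda> \<Longrightarrow> y \<in> \<Lambda> \<Longrightarrow> x \<star> y \<in> \<Lambda>"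
  using subgroup.m_closed[OF subgroup, of "G x" "G y"] by (simp add: \<Lambda>_def G_comp)

lemma \<Lambda>_minus: "x \<in> \<Lambda> \<Longrightarrow> - x \<in> \<Lambda>"
  using subgroup.m_inv_closed[OF subgroup, of "G x"] by (simp add: \<Lambda>_def L_inv)

lemma q_eq: "q x = (\<lambda>l. G (l \<star> x)) ` \<Lambda>"
proof -
  have "q x = (\<lambda>g. g \<circ> G x) ` \<Gamma>" by (auto simp: q_def coset_proj_def r_coset_def)
  also have "\<dots> = (\<lambda>g. g \<circ> G x) ` G ` \<Lambda>" using \<Gamma>_eq by (rule arg_cong)
  finally show ?thesis by (simp add: image_image G_comp)
qed

lemma q_eq_iff: "q x = q y \<longleftrightarrow> (\<exists>l\<in>\<Lambda>. y = l \<star> x)"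
proof
  assume "q x = q y"
  moreover have "G y \<in> q y" using \<Lambda>_0 by (force simp: q_eq)
  ultimately have "G y \<in> (\<lambda>l. G (l \<star> x)) ` \<Lambda>" by (metis q_eq)
  then show "\<exists>l\<in>\<Lambda>. y = l \<star> x" by auto
next
  assume "\<exists>l\<in>\<Lambda>. y = l \<star> x"
  then obtain l where l: "l \<in> \<Lambda>" "y = l \<star> x" by blast
  have "(\<lambda>k. k \<star> l) ` \<Lambda> = \<Lambda>"
  proof
    show "(\<lambda>k. k \<star> l) ` \<Lambda> \<subseteq> \<Lambda>" using l \<Lambda>_star by blast
    show "\<Lambda> \<subseteq> (\<lambda>k. k \<star> l) ` \<Lambda>"
    proof
      fix k assume "k \<in> \<Lambda>"
      then show "k \<in> (\<lambda>k. k \<star> l) ` \<Lambda>" using l \<Lambda>_star[OF _ \<Lambda>_minus[OF l(1)]]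
        by (intro image_eqI[of _ _ "k \<star> - l"]) auto
    qed
  qed
  then have "q x = (\<lambda>l. G (l \<star> x)) ` ((\<lambda>k. k \<star> l) ` \<Lambda>)" by (simp add: q_eq)
  also have "\<dots> = q y" unfolding q_eq l(2) image_image star_assoc ..
  finally show "q x = q y" .
qed

lemma q_star [simp]: "l \<in> \<Lambda> \<Longrightarrow> q (l \<star> x) = q x"
  using q_eq_iff by metis

lemma rcosets_eq: "rcosets\<^bsub>L\<^esub> \<Gamma> = range q"
  by (auto simp: RCOSETS_def carrier_L q_def coset_proj_def)

lemma q_r_coset: "q x #>\<^bsub>L\<^esub> G y = q (x \<star> y)"
  by (auto simp: q_eq r_coset_def G_comp star_assoc)

lemma pi_hom_q: "pi_hom K \<eta> \<Gamma> (G X) (q x) = q (x \<star> - X)"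
  by (simp add: pi_hom_def rcosets_eq L_inv q_r_coset)

lemma discrete_ball: "\<exists>d>0. \<forall>x\<in>\<Lambda>. norm x < d \<longrightarrow> x = 0"
proof -
  have sub: "\<Gamma> \<subseteq> range G" using \<Gamma>_eq by blast
  have "openin (subtopology (mtop (L_mfd K \<eta>)) \<Gamma>) {G 0}"
    using \<Lambda>_0 by (simp add: discrete \<Lambda>_def)
  then have "openin (top_of_set \<Gamma>) {G 0}"
    using sub by (simp add: L_mfd_def carrier_L subtopology_subtopology inf_absorb2)
  then obtain U where U: "open U" "{G 0} = \<Gamma> \<inter> U" by (auto simp: openin_open)
  have "open (G -` U)" using continuous_on_G U(1) by (simp add: continuous_on_open_vimage)
  moreover have "0 \<in> G -` U" using U by auto
  ultimately obtain d where d: "d > 0" "ball 0 d \<subseteq> G -` U" using openE by blast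
  have "x = 0" if "x \<in> \<Lambda>" "norm x < d" for x
  proof -
    have "x \<in> G -` U" using d that by auto
    then have "G x \<in> \<Gamma> \<inter> U" using that by (simp add: \<Lambda>_def)
    then have "G x = G 0" using U by blast
    then show ?thesis by simp
  qed
  then show ?thesis using d by blast
qed

text \<open>The element relating \<open>a\<close> to \<open>b\<close> is
  \<open>b \<star> - a\<close>, which by continuity is close to \<open>0\<close> when both are close
  to \<open>y\<close>; discreteness then makes it \<open>0\<close>.\<close>

lemma \<Lambda>_locally_single:
  "\<exists>r>0. \<forall>a\<in>ball y r. \<forall>b\<in>ball y r. \<forall>l\<in>\<Lambda>. b = l \<star> a \<longrightarrow> l = 0"
proof -
  obtain d where d: "d > 0" "\<And>x. x \<in> \<Lambda> \<Longrightarrow> norm x < d \<Longrightarrow> x = 0" using discrete_ball by blast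
  have "continuous_on UNIV (\<lambda>p. norm (snd p \<star> - fst p))"
    by (intro continuous_intros)
  then have "open ((\<lambda>p. norm (snd p \<star> - fst p)) -` {..<d})"
    by (simp add: continuous_on_open_vimage)
  moreover have "(y, y) \<in> (\<lambda>p. norm (snd p \<star> - fst p)) -` {..<d}" using d by simp
  ultimately obtain A B where AB: "open A" "open B" "(y, y) \<in> A \<times> B"
    "A \<times> B \<subseteq> (\<lambda>p. norm (snd p \<star> - fst p)) -` {..<d}" by (rule open_prod_elim)
  then have "open (A \<inter> B)" "y \<in> A \<inter> B" by auto
  then obtain r where "r > 0" "ball y r \<subseteq> A \<inter> B" using openE by blast
  then have r: "r > 0" "ball y r \<times> ball y r \<subseteq> (\<lambda>p. norm (snd p \<star> - fst p)) -` {..<d}"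
    using AB(4) by auto
  have "l = 0" if "a \<in> ball y r" "b \<in> ball y r" "l \<in> \<Lambda>" "b = l \<star> a" for a b l
  proof -
    have "(a, b) \<in> (\<lambda>p. norm (snd p \<star> - fst p)) -` {..<d}" using r that by blast
    then have "norm l < d" using that by simp
    then show ?thesis using d that by blast
  qed
  then show ?thesis using r by blast
qed

lemma closed_\<Lambda>: "closed \<Lambda>"
  unfolding closed_limpt
proof (intro allI impI)
  fix y assume y: "y islimpt \<Lambda>"
  obtain r where r: "r > 0" "\<And>a b l. \<lbrakk>a \<in> ball y r; b \<in> ball y r; l \<in> \<Lambda>; b = l \<star> a\<rbrakk> \<Longrightarrow> l = 0"
    using \<Lambda>_locally_single by blast
  have single: "a = b" if "a \<in> \<Lambda>" "b \<in> \<Lambda>" "a \<in> ball y r" "b \<in> ball y r" for a b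
  proof -
    have "b = (b \<star> - a) \<star> a" by simp
    moreover have "b \<star> - a \<in> \<Lambda>" using that \<Lambda>_star \<Lambda>_minus by blast
    ultimately have "b \<star> - a = 0" using r(2) that by blast
    then show ?thesis by (metis star_0(1) star_cancel_right(2))
  qed
  obtain a where a: "a \<in> \<Lambda>" "a \<in> ball y r" "a \<noteq> y"
    using y r(1) unfolding islimpt_approachable by (metis dist_commute mem_ball)
  obtain b where b: "b \<in> \<Lambda>" "b \<noteq> y" "dist b y < min r (dist a y)"
    using y r(1) a(3) unfolding islimpt_approachable by (metis min_less_iff_conj zero_less_dist_iff)
  \<comment> \<open>This contradicts \<open>dist b y < dist a y\<close>: there are no limit points,
    and the goal holds vacuously.\<close>
  have "a = b" using single a b by (simp add: dist_commute)
  then show "y \<in> \<Lambda>" using b by simp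
qed

lemma q_inj_ball: "\<exists>r>0. inj_on q (ball y r)"
proof -
  obtain r where r: "r > 0" "\<And>a b l. \<lbrakk>a \<in> ball y r; b \<in> ball y r; l \<in> \<Lambda>; b = l \<star> a\<rbrakk> \<Longrightarrow> l = 0"
    using \<Lambda>_locally_single by blast
  have "inj_on q (ball y r)"
    by (rule inj_onI) (metis q_eq_iff r(2) star_0(1))
  then show ?thesis using r by blast
qed

end

context isotropic_three_vector
begin

text \<open>The mixed terms cancel by skewness, and the quadratic term
  \<open>pinner K (E X v) (E X w)\<close> vanishes because \<open>E X (E X w) = 0\<close>.\<close>

lemma linear_isometry_id_plus_E: "linear_isometry K (\<lambda>v. v + E X v)"
  unfolding linear_isometry_def
proof (intro conjI allI)
  show "linear (\<lambda>v. v + E X v)"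
    by (intro linear_compose_add linear_E_right) (simp add: linear_id[unfolded id_def])
  fix v w
  show "pinner K (v + E X v) (w + E X w) = pinner K v w"
    using E_skew_pinner[of X v w] E_skew_pinner[of X v "E X w"]
    by (simp add: pinner_add_left pinner_add_right)
qed

end

section \<open>Affine isometries and chart parametrizations\<close>

definition affine_isometry :: "'n::finite set \<Rightarrow> (real^'n \<Rightarrow> real^'n) \<Rightarrow> bool" where
  "affine_isometry K F \<longleftrightarrow> (\<exists>A b. linear_isometry K A \<and> F = (\<lambda>x. A x + b))"

lemma affine_isometry_id: "affine_isometry K (\<lambda>x. x)"
  unfolding affine_isometry_def linear_isometry_def
  by (intro exI[of _ "\<lambda>x. x"] exI[of _ 0]) (simp add: linear_id[unfolded id_def])

lemma affine_isometry_comp: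
  assumes "affine_isometry K F" "affine_isometry K F'"
  shows "affine_isometry K (\<lambda>x. F (F' x))"
proof -
  obtain A b A' b' where *: "linear_isometry K A" "F = (\<lambda>x. A x + b)"
    "linear_isometry K A'" "F' = (\<lambda>x. A' x + b')"
    using assms unfolding affine_isometry_def by blast
  have "linear_isometry K (A \<circ> A')"
    using * unfolding linear_isometry_def by (simp add: linear_compose)
  moreover have "(\<lambda>x. F (F' x)) = (\<lambda>x. (A \<circ> A') x + (A b' + b))"
    using * by (simp add: linear_isometry_def linear_add add.assoc)
  ultimately show ?thesis unfolding affine_isometry_def by blast
qed

lemma affine_isometry_continuous: "affine_isometry K F \<Longrightarrow> continuous_on S F"
  unfolding affine_isometry_def linear_isometry_def linear_conv_bounded_linear
  using continuous_on_add[OF linear_continuous_on continuous_on_const] by fastforce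

lemma affine_isometry_smooth_on: "affine_isometry K F \<Longrightarrow> smooth_on S F"
  unfolding affine_isometry_def linear_isometry_def linear_conv_bounded_linear
  using smooth_on_affine by blast

lemma linear_isometry_gram:
  assumes "linear_isometry K A"
  shows "gram K = transpose (matrix A) ** gram K ** matrix A"
  using assms by (simp add: gram_pullback_iff linear_isometry_def)

text \<open>Serves local representatives of maps into \<open>M\<close>: near each point they agree
  with some affine isometry, which may vary from point to point.\<close>

lemma locally_affine_isometry:
  fixes f :: "real^'n \<Rightarrow> real^'n::finite"
  assumes loc: "\<And>x. x \<in> S \<Longrightarrow> \<exists>U F. open U \<and> x \<in> U \<and> affine_isometry K F \<and> (\<forall>y\<in>U. f y = F y)"
  shows "smooth_on S f"
    and "\<And>x. x \<in> S \<Longrightarrow> gram K = transpose (jacobian f (at x)) ** gram K ** jacobian f (at x)"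
proof -
  show "smooth_on S f"
    unfolding smooth_on_def
  proof
    fix k show "Ck_on k S f"
    proof (rule Ck_on_local)
      fix x assume "x \<in> S"
      then obtain U F where "open U" "x \<in> U" "affine_isometry K F" "\<forall>y\<in>U. f y = F y"
        using loc by blast
      then have "open U \<and> x \<in> U \<and> Ck_on k U f"
        using Ck_on_cong[of U k F f] affine_isometry_smooth_on[of K F U] by (auto simp: smooth_on_def)
      then show "\<exists>U. open U \<and> x \<in> U \<and> Ck_on k U f" by blast
    qed
  qed
  fix x assume "x \<in> S"
  then obtain U F where U: "open U" "x \<in> U" and F: "affine_isometry K F" and eq: "\<forall>y\<in>U. f y = F y"
    using loc by blast
  obtain A b where A: "linear_isometry K A" "F = (\<lambda>x. A x + b)"
    using F unfolding affine_isometry_def by blast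
  have bl: "bounded_linear A" using A by (simp add: linear_isometry_def linear_conv_bounded_linear)
  have "F differentiable (at x)"
    using smooth_on_affine[OF bl, of UNIV b] A(2) unfolding smooth_on_def
    by (metis Ck_on.simps(2) UNIV_I)
  then have "frechet_derivative F (at x) = frechet_derivative f (at x)"
    using frechet_derivative_transform_within_open[OF _ U] eq by metis
  then have "frechet_derivative f (at x) = A" using frechet_derivative_affine[OF bl] A(2) by metis
  then have "jacobian f (at x) = matrix A" by (simp add: jacobian_def)
  then show "gram K = transpose (jacobian f (at x)) ** gram K ** jacobian f (at x)"
    using linear_isometry_gram[OF A(1)] by simp
qed

text \<open>The inverse of the \<open>i\<close>-th chart is the restriction of \<open>P\<close> to \<open>U\<close>.\<close>

definition parametrizes ::
  "(real^'n \<Rightarrow> 'a) \<Rightarrow> (real^'n) set \<Rightarrow> ('a, 'i, 'n::finite) mfd \<Rightarrow> 'i \<Rightarrow> bool" where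
  "parametrizes P U X i \<longleftrightarrow>
     open U \<and> P ` U = chart_dom X i \<and> (\<forall>x\<in>U. chart_map X i (P x) = x)"

lemma parametrizes_chart_img: "parametrizes P U X i \<Longrightarrow> chart_img X i = U"
  unfolding parametrizes_def chart_img_def by (auto simp: image_image dest!: sym[of "P ` U"])

lemma parametrizes_chart_inv:
  assumes "parametrizes P U X i" "x \<in> U" shows "chart_inv X i x = P x"
  unfolding chart_inv_def
proof (rule the_inv_into_f_eq)
  show "inj_on (chart_map X i) (chart_dom X i)"
    by (rule inj_on_inverseI[of _ P]) (use assms in \<open>auto simp: parametrizes_def dest!: sym[of "P ` U"]\<close>)
qed (use assms in \<open>auto simp: parametrizes_def\<close>)

lemma parametrizes_local_dom:
  assumes "parametrizes P U X i"
  shows "local_dom X i Y j f = {x \<in> U. f (P x) \<in> chart_dom Y j}"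
proof -
  have dom: "chart_dom X i = P ` U" and inv: "\<And>x. x \<in> U \<Longrightarrow> chart_map X i (P x) = x"
    using assms by (auto simp: parametrizes_def)
  have "{p \<in> P ` U. f p \<in> chart_dom Y j} = P ` {x \<in> U. f (P x) \<in> chart_dom Y j}" by auto
  then show ?thesis unfolding local_dom_def dom using inv by (auto simp: image_image)
qed

lemma parametrizes_local_rep:
  "parametrizes P U X i \<Longrightarrow> x \<in> U \<Longrightarrow> local_rep X i Y j f x = chart_map Y j (f (P x))"
  by (simp add: local_rep_def parametrizes_chart_inv)

context isotropic_three_vector
begin

lemma affine_isometry_star_left: "affine_isometry K (\<lambda>x. l \<star> x)"
  unfolding affine_isometry_def
  by (intro exI[of _ "\<lambda>v. v + E l v"] exI[of _ l]) (auto simp: linear_isometry_id_plus_E star_def)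

text \<open>By skewness of \<open>E\<close> the linear part of the right translation by
  \<open>b\<close> is the identity plus \<open>E (- b)\<close>.\<close>

lemma affine_isometry_star_right: "affine_isometry K (\<lambda>x. x \<star> b)"
proof -
  have "x \<star> b = (x + E (- b) x) + b" for x
    using E_skew[of b x] by (simp add: star_def E.minus_left)
  then have eq: "(\<lambda>x. x \<star> b) = (\<lambda>x. (\<lambda>v. v + E (- b) v) x + b)" by simp
  show ?thesis unfolding affine_isometry_def
    by (rule exI[of _ "\<lambda>v. v + E (- b) v"], rule exI[of _ b]) (simp only: linear_isometry_id_plus_E eq simp_thms)
qed

lemma mtop_L: "mtop (L_mfd K \<eta>) = top_of_set (range G)"
  by (simp add: L_mfd_def carrier_L)

lemma openin_L_image: "openin (top_of_set (range G)) (G ` A) \<longleftrightarrow> open A"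
proof
  assume "openin (top_of_set (range G)) (G ` A)"
  then obtain V where V: "open V" "G ` A = range G \<inter> V" by (auto simp: openin_open)
  have "x \<in> A \<longleftrightarrow> G x \<in> V" for x
  proof -
    have "G x \<in> G ` A \<longleftrightarrow> G x \<in> V" using V(2) by blast
    then show ?thesis by (simp add: image_iff)
  qed
  then have "A = G -` V" by blast
  then show "open A" using continuous_on_G V(1) by (simp add: continuous_on_open_vimage)
next
  assume "open A"
  then show "openin (top_of_set (range G)) (G ` A)"
    using homeomorphism_imp_open_map[OF G_homeomorphism] by simp
qed

lemma openin_L_D:
  assumes "openin (top_of_set (range G)) W"
  obtains U where "open U" "W = G ` U"
proof -
  obtain U where "W = G ` U" using openin_imp_subset[OF assms] by (meson subset_imageE)
  then show thesis using that assms openin_L_image by blast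
qed

lemma parametrizes_L: "parametrizes G UNIV (L_mfd K \<eta>) i"
  by (simp add: parametrizes_def L_mfd_def carrier_L)

lemma chart_metric_L: "chart_metric (L_mfd K \<eta>) i = (\<lambda>_. gram K)"
  by (simp add: L_mfd_def gram_def)

end

section \<open>Topology, atlas and metric of the quotient\<close>

context discrete_subgroup_L
begin

abbreviation M :: "((real^'n \<Rightarrow> real^'n) set, unit \<times> (real^'n \<Rightarrow> real^'n) set, 'n) mfd" where "M \<equiv> M_mfd K \<eta> \<Gamma>"

lemma mtop_M: "mtop M = quotient_topology (top_of_set (range G)) (coset_proj K \<eta> \<Gamma>)"
  by (simp add: M_mfd_def quotient_mfd_def mtop_L)

lemma openin_M: "openin (mtop M) U \<longleftrightarrow> U \<subseteq> range q \<and> open (q -` U)"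
proof -
  have "{g \<in> range G. coset_proj K \<eta> \<Gamma> g \<in> U} = G ` (q -` U)" by (auto simp: q_def)
  moreover have "coset_proj K \<eta> \<Gamma> ` range G = range q" by (auto simp: q_def)
  ultimately show ?thesis
    by (simp add: mtop_M openin_quotient_topology openin_L_image)
qed

lemma topspace_M: "topspace (mtop M) = range q"
proof -
  have "q -` range q = UNIV" by auto
  then have "openin (mtop M) (range q)" by (simp add: openin_M)
  then have "range q \<subseteq> topspace (mtop M)" by (rule openin_subset)
  moreover have "topspace (mtop M) \<subseteq> range q"
    using openin_M[of "topspace (mtop M)"] openin_topspace by blast
  ultimately show ?thesis by blast
qed

lemma continuous_map_q: "continuous_map euclidean (mtop M) q"
  by (auto simp: continuous_map_def topspace_M openin_M vimage_def)

lemma open_q_vimage: "openin (mtop M) U \<Longrightarrow> open (q -` U)"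
  by (simp add: openin_M)

text \<open>The saturation of \<open>U\<close> is a union of preimages of \<open>U\<close> under
  left translations, which are continuous.\<close>

lemma open_map_q: "open U \<Longrightarrow> openin (mtop M) (q ` U)"
proof -
  assume U: "open U"
  have "q -` (q ` U) = (\<Union>l\<in>\<Lambda>. (\<lambda>x. l \<star> x) -` U)"
    unfolding vimage_def image_iff q_eq_iff by auto
  moreover have "open ((\<lambda>x. l \<star> x) -` U)" for l
    using U continuous_on_star[OF continuous_on_const continuous_on_id, of UNIV l]
    by (simp add: continuous_on_open_vimage)
  ultimately show ?thesis by (auto simp: openin_M)
qed

lemma continuous_map_from_M:
  "f ` range q \<subseteq> topspace Y \<Longrightarrow> continuous_map (mtop M) Y f \<longleftrightarrow> continuous_map euclidean Y (\<lambda>x. f (q x))"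
  by (auto simp: continuous_map_def topspace_M openin_M vimage_def)

text \<open>Having distinct images under \<open>q\<close> is the open condition
  \<open>y' \<star> - x' \<notin> \<Lambda>\<close>, as \<open>\<Lambda>\<close> is closed. A
  product neighbourhood inside it projects to disjoint open sets.\<close>

lemma Hausdorff_M: "Hausdorff_space (mtop M)"
  unfolding Hausdorff_space_def topspace_M
proof (intro allI impI)
  fix p p' assume "p \<in> range q \<and> p' \<in> range q \<and> p \<noteq> p'"
  then obtain x y where xy: "p = q x" "p' = q y" "q x \<noteq> q y" by blast
  let ?S = "{z :: (real^'n) \<times> (real^'n). snd z \<star> - fst z \<notin> \<Lambda>}"
  have "continuous_on UNIV (\<lambda>z :: (real^'n) \<times> (real^'n). snd z \<star> - fst z)" by (intro continuous_intros)
  then have "open ((\<lambda>z :: (real^'n) \<times> (real^'n). snd z \<star> - fst z) -` (- \<Lambda>))"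
    using open_Compl[OF closed_\<Lambda>] by (simp add: continuous_on_open_vimage del: vimage_Compl)
  moreover have "?S = (\<lambda>z. snd z \<star> - fst z) -` (- \<Lambda>)" by auto
  ultimately have "open ?S" by simp
  moreover have nq: "y' \<star> - x' \<notin> \<Lambda> \<longleftrightarrow> q x' \<noteq> q y'" for x' y'
    unfolding q_eq_iff by (metis star_cancel_right)
  ultimately obtain A B where AB: "open A" "open B" "(x, y) \<in> A \<times> B" "A \<times> B \<subseteq> ?S"
    using open_prod_elim[of ?S "(x, y)"] xy by force
  have "disjnt (q ` A) (q ` B)"
    using AB(4) nq unfolding disjnt_iff by force
  then show "\<exists>U V. openin (mtop M) U \<and> openin (mtop M) V \<and> p \<in> U \<and> p' \<in> V \<and> disjnt U V"
    using AB xy open_map_q by blast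
qed

lemma second_countable_M: "second_countable (mtop M)"
proof (rule second_countable_open_map_image[of euclidean _ q])
  show "second_countable (euclidean :: (real^'n) topology)"
  proof -
    obtain B :: "(real^'n) set set" where B: "countable B" "\<And>C. C \<in> B \<Longrightarrow> open C"
      "\<And>S. open S \<Longrightarrow> \<exists>U. U \<subseteq> B \<and> S = \<Union>U"
      using univ_second_countable by blast
    have "\<exists>V\<in>B. x \<in> V \<and> V \<subseteq> S" if "open S" "x \<in> S" for S x
      using B(3)[OF that(1)] that(2) by blast
    then show ?thesis unfolding second_countable_def using B(1,2) by (intro exI[of _ B]) auto
  qed
  show "open_map euclidean (mtop M) q" by (simp add: open_map_def open_map_q)
qed (auto simp: continuous_map_q topspace_M)

lemma chart_idx_M: "(i, G ` U) \<in> chart_idx M \<longleftrightarrow> open U \<and> inj_on q U"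
proof -
  have "inj_on (coset_proj K \<eta> \<Gamma>) (G ` U) \<longleftrightarrow> inj_on q U"
    by (auto simp: inj_on_def q_def)
  moreover have "(i, G ` U) \<in> chart_idx M \<longleftrightarrow>
      openin (top_of_set (range G)) (G ` U) \<and> inj_on (coset_proj K \<eta> \<Gamma>) (G ` U)"
    by (auto simp: M_mfd_def quotient_mfd_def mtop_L) (auto simp: L_mfd_def carrier_L)
  ultimately show ?thesis by (simp add: openin_L_image)
qed

lemma chart_idx_M_D:
  assumes "j \<in> chart_idx M"
  obtains i U where "j = (i, G ` U)" "open U" "inj_on q U"
proof -
  obtain i W where j: "j = (i, W)" by (cases j)
  then have "openin (top_of_set (range G)) W"
    using assms by (simp add: M_mfd_def quotient_mfd_def mtop_L)
  then obtain U where "W = G ` U" by (rule openin_L_D)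
  then show thesis using that assms chart_idx_M j by blast
qed

lemma chart_dom_M: "chart_dom M (i, G ` U) = q ` U"
  by (auto simp: M_mfd_def quotient_mfd_def q_def)

lemma chart_metric_M: "chart_metric M j = (\<lambda>_. gram K)"
  by (cases j) (simp add: M_mfd_def quotient_mfd_def chart_metric_L)

lemma chart_map_M:
  assumes "inj_on q U" "x \<in> U"
  shows "chart_map M (i, G ` U) (q x) = x"
proof -
  have "inj_on (coset_proj K \<eta> \<Gamma>) (G ` U)"
    using assms(1) by (auto simp: inj_on_def q_def)
  then have "the_inv_into (G ` U) (coset_proj K \<eta> \<Gamma>) (q x) = G x"
    using assms by (intro the_inv_into_f_eq) (auto simp: q_def)
  then show ?thesis by (simp add: M_mfd_def quotient_mfd_def L_mfd_def)
qed

lemma parametrizes_M: "open U \<Longrightarrow> inj_on q U \<Longrightarrow> parametrizes q U M (i, G ` U)"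
  by (simp add: parametrizes_def chart_dom_M chart_map_M)

text \<open>The chart inverts the restriction of \<open>q\<close> to \<open>U\<close>, a continuous
  open bijection onto its image.\<close>

lemma homeomorphic_chart_M:
  assumes "open U" "inj_on q U"
  shows "homeomorphic_map (subtopology (mtop M) (q ` U)) (top_of_set U) (chart_map M (i, G ` U))"
proof -
  have "homeomorphic_map (top_of_set U) (subtopology (mtop M) (q ` U)) q"
  proof (rule bijective_open_imp_homeomorphic_map)
    show "continuous_map (top_of_set U) (subtopology (mtop M) (q ` U)) q"
      using continuous_map_q by (simp add: continuous_map_from_subtopology continuous_map_in_subtopology)
    show "open_map (top_of_set U) (subtopology (mtop M) (q ` U)) q"
      unfolding open_map_def
    proof (intro allI impI)
      fix V assume "openin (top_of_set U) V"
      then have "open V" "V \<subseteq> U" using assms(1) by (auto simp: openin_open_eq)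
      then show "openin (subtopology (mtop M) (q ` U)) (q ` V)"
        by (simp add: openin_subset_topspace_eq open_map_q image_mono openin_subtopology_Int2 openin_subtopology inf_absorb1)
           (metis image_mono inf.absorb1 open_map_q)
    qed
    show "q ` topspace (top_of_set U) = topspace (subtopology (mtop M) (q ` U))"
      by (auto simp: topspace_M)
    show "inj_on q (topspace (top_of_set U))" using assms by simp
  qed
  then obtain g where g: "homeomorphic_maps (top_of_set U) (subtopology (mtop M) (q ` U)) q g"
    using homeomorphic_map_maps by blast
  then have "homeomorphic_map (subtopology (mtop M) (q ` U)) (top_of_set U) g"
    using homeomorphic_maps_map homeomorphic_maps_sym by blast
  moreover have "g p = chart_map M (i, G ` U) p" if "p \<in> topspace (subtopology (mtop M) (q ` U))" for p
  proof -
    have "p \<in> q ` U" using that by simp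
    then obtain x where "x \<in> U" "p = q x" by blast
    then show ?thesis using g assms by (simp add: homeomorphic_maps_def chart_map_M)
  qed
  ultimately show ?thesis by (rule homeomorphic_map_eq)
qed

text \<open>Two lifts of the same point differ by a left translation by an element of \<open>\<Lambda>\<close>, and left
  translations are affine isometries.\<close>

lemma affine_lift_charts:
  assumes charts: "\<And>i. i \<in> chart_idx X \<Longrightarrow> \<exists>P U F. parametrizes P U X i \<and> chart_metric X i = (\<lambda>_. gram K) \<and>
      affine_isometry K F \<and> (\<forall>x\<in>U. f (P x) = q (F x))"
  shows "smooth_in_charts X M f" "preserves_metric X M f"
proof -
  have loc: "\<exists>O' F. open O' \<and> x \<in> O' \<and> affine_isometry K F \<and> (\<forall>y\<in>O'. local_rep X i M j f y = F y)"
    if ij: "i \<in> chart_idx X" "j \<in> chart_idx M" and x: "x \<in> local_dom X i M j f" for i j x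
  proof -
    obtain P U F where P: "parametrizes P U X i" and F: "affine_isometry K F"
      and f: "\<And>x. x \<in> U \<Longrightarrow> f (P x) = q (F x)"
      using charts[OF ij(1)] by blast
    obtain k W where j: "j = (k, G ` W)" "open W" "inj_on q W"
      using chart_idx_M_D[OF ij(2)] .
    have U: "open U" using P by (simp add: parametrizes_def)
    have x: "x \<in> U" "q (F x) \<in> q ` W"
      using x f by (auto simp: parametrizes_local_dom[OF P] j chart_dom_M)
    \<comment> \<open>\<open>l\<close> moves the lift \<open>F x\<close> into \<open>W\<close>,
      where the target chart inverts \<open>q\<close>.\<close>
    then obtain l where l: "l \<in> \<Lambda>" "l \<star> F x \<in> W" by (auto simp: q_eq_iff)
    have F': "affine_isometry K (\<lambda>y. l \<star> F y)"
      by (rule affine_isometry_comp[OF affine_isometry_star_left F])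
    let ?O = "U \<inter> (\<lambda>y. l \<star> F y) -` W"
    have "open ?O"
      using U j(2) affine_isometry_continuous[OF F', of UNIV]
      by (simp add: open_Int continuous_on_open_vimage)
    moreover have "local_rep X i M j f y = l \<star> F y" if "y \<in> ?O" for y
    proof -
      have "f (P y) = q (l \<star> F y)" using that f l by simp
      then show ?thesis using that by (simp add: parametrizes_local_rep[OF P] j chart_map_M)
    qed
    ultimately show ?thesis using x l F' by blast
  qed
  show "smooth_in_charts X M f"
    unfolding smooth_in_charts_def
    by (intro ballI locally_affine_isometry(1)) (use loc in blast)
  show "preserves_metric X M f"
    unfolding preserves_metric_def Let_def chart_metric_M
  proof (intro ballI)
    fix i j x assume *: "i \<in> chart_idx X" "j \<in> chart_idx M" "x \<in> local_dom X i M j f"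
    have "gram K = transpose (jacobian (local_rep X i M j f) (at x)) ** gram K ** jacobian (local_rep X i M j f) (at x)"
      by (rule locally_affine_isometry(2)[of "local_dom X i M j f"]) (use loc * in blast)+
    then show "chart_metric X i x = transpose (jacobian (local_rep X i M j f) (at x)) ** gram K ** jacobian (local_rep X i M j f) (at x)"
      using charts[OF *(1)] by auto
  qed
qed

lemma affine_lift:
  assumes "affine_isometry K F" "\<And>x. f (q x) = q (F x)"
  shows "smooth_map M M f" "preserves_metric M M f"
proof -
  have *: "\<exists>P U F. parametrizes P U M i \<and> chart_metric M i = (\<lambda>_. gram K) \<and>
      affine_isometry K F \<and> (\<forall>x\<in>U. f (P x) = q (F x))" if i: "i \<in> chart_idx M" for i
    using chart_idx_M_D[OF i] parametrizes_M chart_metric_M assms by metis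
  have "continuous_map euclidean (mtop M) (\<lambda>x. f (q x))"
    using continuous_map_compose[OF _ continuous_map_q, of euclidean F] affine_isometry_continuous[OF assms(1), of UNIV]
    by (simp add: assms(2) o_def)
  then have "continuous_map (mtop M) (mtop M) f"
    by (subst continuous_map_from_M) (auto simp: topspace_M assms(2))
  then show "smooth_map M M f" unfolding smooth_map_def using affine_lift_charts(1)[OF *] by blast
  show "preserves_metric M M f" by (rule affine_lift_charts(2)[OF *])
qed

text \<open>Chart changes are local representatives of the identity, which lifts to the identity of
  \<open>V\<close>. The metric matrix is \<open>gram K\<close> in every chart, so the remaining
  conditions concern one constant matrix.\<close>

lemma pseudo_riemannian_M: "pseudo_riemannian M"
proof -
  have id: "smooth_map M M (\<lambda>p. p)" "preserves_metric M M (\<lambda>p. p)"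
    using affine_lift[OF affine_isometry_id, of "\<lambda>p. p"] by auto
  have "(\<Union>i\<in>chart_idx M. chart_dom M i) = range q"
  proof
    show "(\<Union>i\<in>chart_idx M. chart_dom M i) \<subseteq> range q"
    proof (rule UN_least)
      fix i assume "i \<in> chart_idx M"
      then obtain k U where "i = (k, G ` U)" by (rule chart_idx_M_D)
      then show "chart_dom M i \<subseteq> range q" by (auto simp: chart_dom_M)
    qed
    show "range q \<subseteq> (\<Union>i\<in>chart_idx M. chart_dom M i)"
    proof clarify
      fix x
      obtain r where "r > 0" "inj_on q (ball x r)" using q_inj_ball by blast
      then show "q x \<in> (\<Union>i\<in>chart_idx M. chart_dom M i)"
        by (intro UN_I[of "((), G ` ball x r)"]) (auto simp: chart_idx_M chart_dom_M)
    qed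
  qed
  moreover have "openin (mtop M) (chart_dom M i) \<and> open (chart_img M i) \<and>
        homeomorphic_map (subtopology (mtop M) (chart_dom M i)) (top_of_set (chart_img M i)) (chart_map M i)"
    if i: "i \<in> chart_idx M" for i
  proof -
    obtain k U where U: "i = (k, G ` U)" "open U" "inj_on q U" using chart_idx_M_D[OF i] .
    then show ?thesis
      using parametrizes_chart_img[OF parametrizes_M, of U k] homeomorphic_chart_M[of U k] open_map_q
      by (simp add: chart_dom_M)
  qed
  ultimately have "smooth_manifold M"
    unfolding smooth_manifold_def topspace_M
    using Hausdorff_M second_countable_M id by (simp add: smooth_map_def)
  then show ?thesis
    unfolding pseudo_riemannian_def
    using id by (simp add: chart_metric_M smooth_on_const transpose_gram invertible_gram)
qed

lemma local_isometry_coset_proj: "local_isometry (L_mfd K \<eta>) M (coset_proj K \<eta> \<Gamma>)"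
proof -
  have *: "\<exists>P U F. parametrizes P U (L_mfd K \<eta>) i \<and> chart_metric (L_mfd K \<eta>) i = (\<lambda>_. gram K) \<and>
      affine_isometry K F \<and> (\<forall>x\<in>U. coset_proj K \<eta> \<Gamma> (P x) = q (F x))" for i
    using parametrizes_L chart_metric_L affine_isometry_id q_def by metis
  have "continuous_map (mtop (L_mfd K \<eta>)) (mtop M) (coset_proj K \<eta> \<Gamma>)"
  proof -
    have "{x \<in> range G. coset_proj K \<eta> \<Gamma> x \<in> U} = G ` (q -` U)" for U by (auto simp: q_def)
    then show ?thesis
      by (auto simp: continuous_map_def mtop_L topspace_M openin_M openin_L_image q_def)
  qed
  then show ?thesis
    unfolding local_isometry_def smooth_map_def using affine_lift_charts[OF *] by blast
qed

text \<open>Constant metric components make all Christoffel symbols vanish.\<close>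

lemma flat_M: "flat M"
proof -
  have "christoffel (\<lambda>_. gram K) a b c = (\<lambda>_. 0)" for a b c
    by (simp add: fun_eq_iff christoffel_def pderiv_at_def)
  then show ?thesis
    unfolding flat_def chart_metric_M by (simp add: riemann_curvature_def pderiv_at_def)
qed

section \<open>Isometries induced by right translations\<close>

text \<open>The inverse comes with an affine lift of its own, so that its smoothness follows from
  \<open>affine_lift\<close> as well.\<close>

lemma isometry_of_lift:
  assumes F: "affine_isometry K F" "\<And>x. f (q x) = q (F x)"
    and F': "affine_isometry K F'" "\<And>x. f' (q x) = q (F' x)"
    and inverse: "\<And>p. p \<in> range q \<Longrightarrow> f' (f p) = p" "\<And>p. p \<in> range q \<Longrightarrow> f (f' p) = p"
  shows "isometry M M f"
proof -
  have bij: "bij_betw f (range q) (range q)"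
    by (rule bij_betw_byWitness[of _ f']) (auto simp: inverse F F')
  have "the_inv_into (range q) f (q x) = q (F' x)" for x
  proof (rule the_inv_into_f_eq)
    show "f (q (F' x)) = q x" using inverse(2)[of "q x"] by (simp add: F')
  qed (use bij in \<open>auto simp: bij_betw_def\<close>)
  then have "smooth_map M M (the_inv_into (range q) f)" using affine_lift F' by blast
  then show ?thesis using bij affine_lift[OF F] unfolding isometry_def topspace_M by blast
qed

lemma pi_hom_Isom: "pi_hom K \<eta> \<Gamma> (G X) \<in> carrier (Isom M)"
proof -
  let ?f = "pi_hom K \<eta> \<Gamma> (G X)" and ?f' = "pi_hom K \<eta> \<Gamma> (G (- X))"
  have inverse: "?f' (?f p) = p" "?f (?f' p) = p" if "p \<in> range q" for p
    using that by (auto simp: pi_hom_q)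
  have iso: "isometry M M ?f"
    by (rule isometry_of_lift[OF affine_isometry_star_right[of "- X"] pi_hom_q affine_isometry_star_right[of "- (- X)"] pi_hom_q inverse])
  then have "bij_betw ?f (range q) (range q)" by (simp add: isometry_def topspace_M)
  moreover have "?f \<in> extensional (range q)"
    by (simp add: pi_hom_def rcosets_eq)
  ultimately show ?thesis
    using iso by (simp add: Isom_def topspace_M Bij_def)
qed

lemma Isom_mult: "f \<in> carrier (Isom M) \<Longrightarrow> g \<in> carrier (Isom M) \<Longrightarrow> f \<otimes>\<^bsub>Isom M\<^esub> g = compose (range q) f g"
  by (simp add: Isom_def BijGroup_def topspace_M)

lemma Isom_one: "\<one>\<^bsub>Isom M\<^esub> = (\<lambda>p\<in>range q. p)"
  by (simp add: Isom_def BijGroup_def topspace_M)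

text \<open>Inversion reverses products and so compensates for multiplying on the right.\<close>

lemma pi_hom_hom: "pi_hom K \<eta> \<Gamma> \<in> hom L (Isom M)"
proof (rule homI)
  fix g assume "g \<in> carrier L"
  then show "pi_hom K \<eta> \<Gamma> g \<in> carrier (Isom M)" using pi_hom_Isom by (auto simp: carrier_L)
next
  fix g h assume "g \<in> carrier L" "h \<in> carrier L"
  then obtain X Y where XY: "g = G X" "h = G Y" by (auto simp: carrier_L)
  have "pi_hom K \<eta> \<Gamma> (G (X \<star> Y)) p = compose (range q) (pi_hom K \<eta> \<Gamma> (G X)) (pi_hom K \<eta> \<Gamma> (G Y)) p" for p
  proof (cases "p \<in> range q")
    case True
    then show ?thesis by (auto simp: compose_def pi_hom_q minus_star star_assoc)
  next
    \<comment> \<open>Off \<open>range q\<close> both sides take the default value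
      \<open>undefined\<close>.\<close>
    case False
    then show ?thesis by (simp add: compose_def pi_hom_def rcosets_eq)
  qed
  then show "pi_hom K \<eta> \<Gamma> (g \<otimes>\<^bsub>L\<^esub> h) = pi_hom K \<eta> \<Gamma> g \<otimes>\<^bsub>Isom M\<^esub> pi_hom K \<eta> \<Gamma> h"
    by (simp add: XY G_comp Isom_mult pi_hom_Isom fun_eq_iff)
qed

lemma homogeneous_M: "homogeneous M"
  unfolding homogeneous_def topspace_M
proof (intro ballI)
  fix p p' assume "p \<in> range q" "p' \<in> range q"
  then obtain x y where "p = q x" "p' = q y" by blast
  \<comment> \<open>The group element is chosen so that multiplying \<open>x\<close> by its inverse
    \<open>- x \<star> y\<close> gives \<open>y\<close>.\<close>
  then have "pi_hom K \<eta> \<Gamma> (G (- y \<star> x)) p = p'"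
    by (simp add: pi_hom_q minus_star)
  then show "\<exists>f\<in>carrier (Isom M). f p = p'" using pi_hom_Isom by blast
qed

end

section \<open>The identity component of the isometry group\<close>

locale lattice_L = discrete_subgroup_L K \<eta> \<Gamma>
  for K :: "'n::finite set" and \<eta> \<Gamma> +
  assumes compact: "compact_space (mtop (M_mfd K \<eta> \<Gamma>))"
begin

section \<open>Uniform estimates from compactness\<close>

text \<open>The images of the balls of integer radius form an open cover of \<open>M\<close>; a
  finite subcover bounds the radius.\<close>

lemma compact_fundamental_domain: "\<exists>R>0. \<forall>x. \<exists>l\<in>\<Lambda>. norm (l \<star> x) \<le> R"
proof -
  let ?\<U> = "range (\<lambda>n::nat. q ` ball 0 (real n))"
  have "range q \<subseteq> \<Union>?\<U>"
  proof clarify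
    fix x :: "real^'n"
    obtain n where "norm x < real n" using reals_Archimedean2 by blast
    then have "q x \<in> q ` ball 0 (real n)" by simp
    then show "q x \<in> \<Union>?\<U>" by blast
  qed
  moreover have "\<forall>U\<in>?\<U>. openin (mtop M) U" using open_map_q by blast
  ultimately obtain \<F> where F: "finite \<F>" "\<F> \<subseteq> ?\<U>" "range q \<subseteq> \<Union>\<F>"
    using compact unfolding compact_space_def compactin_def topspace_M by metis
  obtain I where I: "finite I" "\<F> = (\<lambda>n::nat. q ` ball 0 (real n)) ` I"
    using finite_subset_image[OF F(1,2)] by blast
  \<comment> \<open>Inserting 1 makes the maximum well defined and positive.\<close>
  define R where "R = real (Max (insert 1 I))"
  have "\<exists>l\<in>\<Lambda>. norm (l \<star> x) \<le> R" for x
  proof -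
    have "q x \<in> \<Union>\<F>" using F(3) by blast
    then obtain n where nI: "n \<in> I" "q x \<in> q ` ball 0 (real n)" using I(2) by blast
    then obtain y where "y \<in> ball 0 (real n)" "q x = q y" by blast
    then have n: "n \<in> I" "norm y < real n" "q x = q y" using nI by auto
    then obtain l where "l \<in> \<Lambda>" "y = l \<star> x" by (auto simp: q_eq_iff)
    moreover have "real n \<le> R" unfolding R_def using I(1) n(1) by simp
    ultimately show ?thesis using n(2) by force
  qed
  moreover have "R > 0"
  proof -
    have "1 \<le> Max (insert 1 I)" using I(1) by simp
    then show ?thesis by (simp add: R_def)
  qed
  ultimately show ?thesis by blast
qed

definition R where "R = (SOME R. R > 0 \<and> (\<forall>x. \<exists>l\<in>\<Lambda>. norm (l \<star> x) \<le> R))"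

lemma R: "R > 0" "\<exists>l\<in>\<Lambda>. norm (l \<star> x) \<le> R"
  using someI_ex[OF compact_fundamental_domain] unfolding R_def[symmetric] by blast+

text \<open>Conjugates of \<open>l\<close> by elements of the lattice stay in the lattice, so \<open>x\<close> may be taken
  in a compact fundamental domain; there conjugation distorts norms by a bounded factor.\<close>

lemma conjugates_uniformly_discrete:
  "\<exists>e>0. \<forall>x. \<forall>l\<in>\<Lambda>. norm (- x \<star> l \<star> x) < e \<longrightarrow> l = 0"
proof -
  obtain d where d: "d > 0" "\<And>x. x \<in> \<Lambda> \<Longrightarrow> norm x < d \<Longrightarrow> x = 0" using discrete_ball by blast
  obtain C where C: "C > 0" "\<And>a b. norm (E a b) \<le> norm a * norm b * C" using E.pos_bounded by blast
  \<comment> \<open>Conjugation by an element of norm at most \<open>R\<close> enlarges norms by at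
    most the factor \<open>1 + 2 * R * C\<close>.\<close>
  define e where "e = d / (1 + 2 * R * C)"
  have pos: "1 + 2 * R * C > 0" using R(1) C(1) by (simp add: add_pos_pos)
  have "l = 0" if l: "l \<in> \<Lambda>" "norm (- x \<star> l \<star> x) < e" for x l
  proof -
    obtain m where m: "m \<in> \<Lambda>" "norm (m \<star> x) \<le> R" using R(2) by blast
    define c where "c = m \<star> x"
    define n where "n = m \<star> l \<star> - m"
    define w where "w = - x \<star> l \<star> x"
    have "w = - c \<star> n \<star> c" by (simp add: w_def c_def n_def minus_star star_assoc)
    then have "n = c \<star> w \<star> - c" by (simp add: star_assoc)
    then have n: "n = w - 2 *\<^sub>R E w c"
      using star_conjugate[of "- c" w] by (simp add: E.minus_right)
    have "norm n \<le> norm w + 2 * norm (E w c)"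
      unfolding n using norm_triangle_ineq4[of w "2 *\<^sub>R E w c"] by simp
    also have "norm (E w c) \<le> norm w * R * C"
    proof (rule order_trans[OF C(2)])
      show "norm w * norm c * C \<le> norm w * R * C"
        using m(2) C(1) unfolding c_def by (intro mult_right_mono mult_left_mono) auto
    qed
    finally have "norm n \<le> norm w * (1 + 2 * R * C)" by (simp add: algebra_simps)
    also have "\<dots> < e * (1 + 2 * R * C)"
      using l(2) pos unfolding w_def by (rule mult_strict_right_mono)
    also have "\<dots> = d" using pos by (simp add: e_def)
    finally have "n = 0" using d(2) l(1) m(1) \<Lambda>_star \<Lambda>_minus unfolding n_def by blast
    then have "m \<star> l = m" unfolding n_def by (metis star_0(1) star_cancel_right(2))
    then show "l = 0" by (metis star_0(2) star_left_cancel)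
  qed
  moreover have "e > 0" using d(1) pos by (simp add: e_def)
  ultimately show ?thesis by blast
qed

text \<open>If \<open>l\<close> takes \<open>x \<star> b\<close> to \<open>x \<star> b'\<close>,
  then \<open>- x \<star> l \<star> x = b' \<star> - b\<close>, which is small independently of
  \<open>x\<close>; hence \<open>l = 0\<close>.\<close>

lemma uniform_injectivity:
  "\<exists>e>0. \<forall>x b b'. norm b < e \<longrightarrow> norm b' < e \<longrightarrow> q (x \<star> b) = q (x \<star> b') \<longrightarrow> b = b'"
proof -
  obtain d where d: "d > 0" "\<And>x l. l \<in> \<Lambda> \<Longrightarrow> norm (- x \<star> l \<star> x) < d \<Longrightarrow> l = 0"
    using conjugates_uniformly_discrete by blast
  obtain C where C: "C > 0" "\<And>a b. norm (E a b) \<le> norm a * norm b * C" using E.pos_bounded by blast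
  \<comment> \<open>The bound by 1 makes the bilinear term at most \<open>e * C\<close>, and the
    total stays below \<open>e * (2 + C) \<le> d\<close>.\<close>
  define e where "e = min 1 (d / (2 + C))"
  have e: "e > 0" "e \<le> 1" using d(1) C(1) by (auto simp: e_def)
  have "e \<le> d / (2 + C)" by (simp add: e_def)
  then have eC: "e * (2 + C) \<le> d" using C(1) by (simp add: pos_le_divide_eq)
  have "b = b'" if b: "norm b < e" "norm b' < e" "q (x \<star> b) = q (x \<star> b')" for x b b'
  proof -
    obtain l where l: "l \<in> \<Lambda>" "x \<star> b' = l \<star> (x \<star> b)" using b(3) q_eq_iff by blast
    have "b' \<star> - b = - x \<star> (x \<star> b') \<star> - b" by (simp add: star_assoc)
    also have "\<dots> = - x \<star> l \<star> x" unfolding l(2) by (simp add: star_assoc)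
    finally have eq: "- x \<star> l \<star> x = b' \<star> - b" ..
    have "norm (b' \<star> - b) \<le> norm b' + norm b + norm (E b' b)"
      unfolding star_def using norm_triangle_ineq4[of "b' - b" "E b' b"] norm_triangle_ineq4[of b' b]
      by (simp add: E.minus_right)
    also have "norm (E b' b) \<le> e * 1 * C"
      by (rule order_trans[OF C(2)]) (use b e C in \<open>intro mult_mono; auto\<close>)
    also have "norm b' + norm b + e * 1 * C < d" using b eC by (simp add: algebra_simps)
    finally have "l = 0" using d(2)[OF l(1), of x] by (simp add: eq)
    then show ?thesis using l(2) by (simp add: star_left_cancel)
  qed
  then show ?thesis using e(1) by blast
qed

section \<open>The compact-open topology on the isometry group\<close>

lemma topspace_Isom_top: "topspace (Isom_top M) = carrier (Isom M)"
proof
  show "topspace (Isom_top M) \<subseteq> carrier (Isom M)" by (auto simp: Isom_top_def)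
  \<comment> \<open>For the empty compact set the subbasic set is the whole group.\<close>
  have "openin (Isom_top M) {f \<in> carrier (Isom M). f ` {} \<subseteq> {}}"
    unfolding Isom_top_def
    by (rule topology_generated_by_Basis) (use compactin_empty openin_empty in blast)
  then show "carrier (Isom M) \<subseteq> topspace (Isom_top M)"
    using openin_subset by fastforce
qed

lemma openin_Isom_top: "compactin (mtop M) C \<Longrightarrow> openin (mtop M) U \<Longrightarrow>
    openin (Isom_top M) {f \<in> carrier (Isom M). f ` C \<subseteq> U}"
  unfolding Isom_top_def by (rule topology_generated_by_Basis) blast

lemma compactin_q: "compact C \<Longrightarrow> compactin (mtop M) (q ` C)"
  by (rule image_compactin[of euclidean]) (simp_all add: continuous_map_q)

lemma Isom_D:
  assumes "f \<in> carrier (Isom M)"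
  shows "f \<in> extensional (range q)" "bij_betw f (range q) (range q)" "isometry M M f"
  using assms by (auto simp: Isom_def topspace_M Bij_def)

text \<open>The image of \<open>U\<close> under \<open>f\<close> is its preimage under the
  continuous inverse.\<close>

lemma Isom_open_image:
  assumes f: "f \<in> carrier (Isom M)" and U: "openin (mtop M) U"
  shows "openin (mtop M) (f ` U)"
proof -
  let ?g = "the_inv_into (range q) f"
  have cont: "continuous_map (mtop M) (mtop M) ?g"
    using Isom_D(3)[OF f] by (simp add: isometry_def smooth_map_def topspace_M)
  have sub: "U \<subseteq> range q" using openin_subset[OF U] by (simp add: topspace_M)
  have bij: "inj_on f (range q)" "f ` range q = range q" using Isom_D(2)[OF f] by (auto simp: bij_betw_def)
  have "f ` U = {p \<in> range q. ?g p \<in> U}"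
  proof (rule subset_antisym; rule subsetI)
    fix p assume "p \<in> f ` U"
    then obtain u where u: "u \<in> U" "p = f u" by blast
    then have mem: "u \<in> range q" using sub by blast
    have "?g (f u) = u" by (rule the_inv_into_f_f[OF bij(1) mem])
    moreover have "f u \<in> f ` range q" using mem by (rule imageI)
    ultimately show "p \<in> {p \<in> range q. ?g p \<in> U}" using u bij(2) by simp
  next
    fix p assume p: "p \<in> {p \<in> range q. ?g p \<in> U}"
    then have "p \<in> f ` range q" using bij(2) by simp
    then have "f (?g p) = p" by (rule f_the_inv_into_f[OF bij(1)])
    then show "p \<in> f ` U" using p by (metis (no_types, lifting) imageI mem_Collect_eq)
  qed
  then show ?thesis using openin_continuous_map_preimage[OF cont U] by (simp add: topspace_M)
qed

text \<open>Turns the compact-open topology into uniform closeness, measured by a right factor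
  \<open>b\<close>. Finitely many balls control the fundamental domain; right factors commute with
  the left action of \<open>\<Lambda>\<close>, so the estimate extends to all
  \<open>x\<close>.\<close>

lemma Isom_top_neighbourhood:
  assumes f: "f \<in> carrier (Isom M)" and e: "e > 0"
  shows "\<exists>N. openin (Isom_top M) N \<and> f \<in> N \<and>
    (\<forall>h\<in>N. \<forall>x. \<exists>b. norm b < e \<and> h (q x) = f (q (x \<star> b)))"
proof -
  \<comment> \<open>Around each centre, points of the doubled ball are reached from points of the
    closed ball by right factors of norm below \<open>e\<close>.\<close>
  have "\<exists>r>0. \<forall>x\<in>cball c r. \<forall>y\<in>ball c (2 * r). norm (- x \<star> y) < e" for c
  proof -
    have "continuous_on UNIV (\<lambda>p. norm (- fst p \<star> snd p))" by (intro continuous_intros)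
    then have "open ((\<lambda>p. norm (- fst p \<star> snd p)) -` {..<e})"
      by (simp add: continuous_on_open_vimage)
    moreover have "(c, c) \<in> (\<lambda>p. norm (- fst p \<star> snd p)) -` {..<e}" using e by simp
    ultimately obtain A B where AB: "open A" "open B" "(c, c) \<in> A \<times> B"
      "A \<times> B \<subseteq> (\<lambda>p. norm (- fst p \<star> snd p)) -` {..<e}" by (rule open_prod_elim)
    then have "open (A \<inter> B)" "c \<in> A \<inter> B" by auto
    then obtain s where s: "s > 0" "ball c s \<subseteq> A \<inter> B" using openE by blast
    show ?thesis
    proof (intro exI[of _ "s / 2"] conjI ballI)
      fix x y assume "x \<in> cball c (s / 2)" "y \<in> ball c (2 * (s / 2))"
      then have "x \<in> ball c s" "y \<in> ball c s" using s(1) by auto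
      then have "(x, y) \<in> A \<times> B" using s(2) by blast
      then show "norm (- x \<star> y) < e" using AB(4) by auto
    qed (use s in auto)
  qed
  then obtain r where r: "\<And>c. r c > 0"
    "\<And>c x y. x \<in> cball c (r c) \<Longrightarrow> y \<in> ball c (2 * r c) \<Longrightarrow> norm (- x \<star> y) < e" by metis
  have cover: "cball (0::real^'n) R \<subseteq> (\<Union>c\<in>UNIV. ball c (r c))" using centre_in_ball r(1) by blast
  obtain T where T: "finite T" "cball (0::real^'n) R \<subseteq> (\<Union>c\<in>T. ball c (r c))"
    by (rule compactE_image[OF compact_cball _ cover]) auto
  define S where "S c = {h \<in> carrier (Isom M). h ` q ` cball c (r c) \<subseteq> f ` q ` ball c (2 * r c)}" for c
  define N where "N = \<Inter>(insert (carrier (Isom M)) (S ` T))"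
  have "openin (Isom_top M) (S c)" for c
    unfolding S_def
    by (rule openin_Isom_top) (simp_all add: compactin_q Isom_open_image[OF f] open_map_q)
  moreover have "openin (Isom_top M) (carrier (Isom M))"
    by (metis openin_topspace topspace_Isom_top)
  ultimately have "openin (Isom_top M) N"
    unfolding N_def using T(1) by (intro openin_Inter) auto
  moreover have "f \<in> S c" for c
  proof -
    have "cball c (r c) \<subseteq> ball c (2 * r c)" using r(1)[of c] by auto
    then show ?thesis using f unfolding S_def by (simp add: image_mono)
  qed
  then have "f \<in> N" using f by (simp add: N_def)
  moreover have "\<exists>b. norm b < e \<and> h (q x) = f (q (x \<star> b))" if h: "h \<in> N" for h x
  proof -
    obtain m where m: "m \<in> \<Lambda>" "norm (m \<star> x) \<le> R" using R(2) by blast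
    then obtain c where c: "c \<in> T" "m \<star> x \<in> ball c (r c)" using T(2) by force
    then have mem: "m \<star> x \<in> cball c (r c)" by auto
    have "h \<in> S c" using h c(1) by (simp add: N_def)
    then have "h (q (m \<star> x)) \<in> f ` q ` ball c (2 * r c)" using mem unfolding S_def by blast
    then obtain y where y: "y \<in> ball c (2 * r c)" "h (q x) = f (q y)" using m(1) by auto
    \<comment> \<open>The right factor leading from \<open>m \<star> x\<close> to \<open>y\<close>
      leads from \<open>x\<close> to \<open>- m \<star> y\<close>, another lift of
      \<open>q y\<close>.\<close>
    have "q (x \<star> (- (m \<star> x) \<star> y)) = q (- m \<star> y)" by (simp add: minus_star star_assoc)
    also have "\<dots> = q y" using m(1) \<Lambda>_minus by simp
    finally show ?thesis using y r(2)[OF mem y(1)] by (intro exI[of _ "- (m \<star> x) \<star> y"]) simp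
  qed
  ultimately show ?thesis by blast
qed

section \<open>Rigidity of lifted isometries\<close>

text \<open>A vector \<open>a\<close> orthogonal to \<open>\<Lambda>\<close> and to all values of
  \<open>E\<close> would have a component that left translations by \<open>\<Lambda>\<close> cannot
  change, contradicting cocompactness. The values of \<open>E\<close> already lie in the span of
  \<open>\<Lambda>\<close>, through commutators.\<close>

lemma span_\<Lambda>: "span \<Lambda> = UNIV"
proof -
  let ?S = "{E X Y |X Y. True}"
  have 1: "span (\<Lambda> \<union> ?S) = UNIV"
  proof (rule ccontr)
    assume "span (\<Lambda> \<union> ?S) \<noteq> UNIV"
    then obtain a where a: "a \<noteq> 0" "\<And>x. x \<in> span (\<Lambda> \<union> ?S) \<Longrightarrow> a \<bullet> x = 0"
      using span_not_UNIV_orthogonal by blast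
    \<comment> \<open>A vector of norm \<open>R + 1\<close> along \<open>a\<close>, too long to be
      moved into the ball of radius \<open>R\<close>.\<close>
    define x where "x = ((R + 1) / norm a) *\<^sub>R a"
    obtain l where l: "l \<in> \<Lambda>" "norm (l \<star> x) \<le> R" using R(2) by blast
    have "a \<bullet> l = 0" "a \<bullet> E l x = 0" by (rule a(2), rule span_base, use l in blast)+
    then have "a \<bullet> (l \<star> x) = a \<bullet> x" by (simp add: star_def inner_add_right)
    also have "\<dots> = (R + 1) * norm a" using a(1) by (simp add: x_def dot_square_norm power2_eq_square)
    finally have "(R + 1) * norm a \<le> norm a * norm (l \<star> x)" using norm_cauchy_schwarz by metis
    also have "\<dots> \<le> norm a * R" using l(2) by (simp add: mult_left_mono)
    finally show False using a(1) by (simp add: algebra_simps)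
  qed
  have E_\<Lambda>: "E l m \<in> span \<Lambda>" if "l \<in> \<Lambda>" "m \<in> \<Lambda>" for l m
  proof -
    have "l \<star> m - m \<star> l \<in> span \<Lambda>" using that \<Lambda>_star by (intro span_diff span_base)
    moreover have "l \<star> m - m \<star> l = 2 *\<^sub>R E l m" using E_skew[of m l] by (simp add: star_def scaleR_2)
    ultimately have "(1/2) *\<^sub>R (2 *\<^sub>R E l m) \<in> span \<Lambda>" by (metis span_scale)
    then show ?thesis by simp
  qed
  have E_span: "E x m \<in> span \<Lambda>" if "x \<in> span \<Lambda>" "m \<in> \<Lambda>" for x m
    using that(1) by (induction rule: span_induct_alt)
      (auto simp: E.zero_left E.add_left E.scaleR_left E_\<Lambda> that(2) intro!: span_add span_scale span_zero)
  have E_span2: "E x y \<in> span \<Lambda>" if "y \<in> span \<Lambda>" "x \<in> span \<Lambda>" for x y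
    using that(1) by (induction rule: span_induct_alt)
      (auto simp: E.zero_right E.add_right E.scaleR_right E_span that(2) intro!: span_add span_scale span_zero)
  have S: "?S \<subseteq> span \<Lambda>"
  proof clarify
    fix X Y
    \<comment> \<open>Modulo the support, which \<open>E\<close> annihilates in both arguments,
      every vector lies in \<open>span \<Lambda>\<close>.\<close>
    have "\<exists>w s. w \<in> span \<Lambda> \<and> s \<in> support K \<eta> \<and> x = w + s" for x
    proof -
      have "x \<in> span (\<Lambda> \<union> ?S)" using 1 by simp
      then show ?thesis unfolding span_Un support_def by blast
    qed
    then obtain w s w' s' where "w \<in> span \<Lambda>" "w' \<in> span \<Lambda>" "s \<in> support K \<eta>" "s' \<in> support K \<eta>"
      "X = w + s" "Y = w' + s'" by metis
    then show "E X Y \<in> span \<Lambda>"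
      by (simp add: E.add_left E.add_right E_support_left E_support_right E_span2)
  qed
  have "span (\<Lambda> \<union> ?S) \<subseteq> span \<Lambda>"
    using S by (intro span_minimal) (auto intro: span_base)
  then show ?thesis using 1 by blast
qed

text \<open>The lift \<open>F\<close> of \<open>h\<close> with \<open>F x\<close> near \<open>x \<star> g\<close> is unique, hence continuous
  and equivariant under \<open>\<Lambda>\<close>. Being a local isometry it is affine, and equivariance forces an affine map to
  be a right translation since \<open>\<Lambda>\<close> spans.\<close>

lemma uniform_lift_imp_pi_hom:
  assumes h: "h \<in> carrier (Isom M)"
    and inj: "\<And>x b b'. norm b < e \<Longrightarrow> norm b' < e \<Longrightarrow> q (x \<star> b) = q (x \<star> b') \<Longrightarrow> b = b'"
    and near: "\<And>x. \<exists>b. norm b < e \<and> h (q x) = q (x \<star> b \<star> g)"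
  shows "\<exists>X. h = pi_hom K \<eta> \<Gamma> (G X)"
proof -
  obtain B where B: "\<And>x. norm (B x) < e" "\<And>x. h (q x) = q (x \<star> B x \<star> g)" using near by metis
  define F where "F x = x \<star> B x \<star> g" for x
  have hF: "h (q x) = q (F x)" for x using B(2) F_def by simp
  \<comment> \<open>Frees \<open>F\<close> from the choice of \<open>B\<close>: \<open>F x\<close>
    is the only lift of \<open>h (q x)\<close> of the form \<open>x \<star> b \<star> g\<close> with
    \<open>norm b < e\<close>.\<close>
  have uniq: "y = F x" if y: "q y = h (q x)" "norm (- x \<star> y \<star> - g) < e" for x y
  proof -
    obtain l where l: "l \<in> \<Lambda>" "F x = l \<star> y" using y(1) hF q_eq_iff by metis
    have "x \<star> B x = F x \<star> - g" by (simp add: F_def)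
    also have "\<dots> = l \<star> (x \<star> (- x \<star> y \<star> - g))" by (simp add: l star_assoc)
    finally have "q (x \<star> B x) = q (x \<star> (- x \<star> y \<star> - g))" using l(1) by simp
    then have "B x = - x \<star> y \<star> - g" using inj[OF B(1) y(2)] by blast
    then show ?thesis by (simp add: F_def star_assoc)
  qed
  have equi: "F (l \<star> x) = l \<star> F x" if "l \<in> \<Lambda>" for l x
  proof (rule uniq[symmetric])
    show "q (l \<star> F x) = h (q (l \<star> x))" using that hF by simp
    have "- (l \<star> x) \<star> (l \<star> F x) \<star> - g = B x" by (simp add: F_def minus_star star_assoc)
    then show "norm (- (l \<star> x) \<star> (l \<star> F x) \<star> - g) < e" using B(1) by simp
  qed
  have iso: "continuous_map (mtop M) (mtop M) h" "smooth_in_charts M M h" "preserves_metric M M h"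
    using Isom_D(3)[OF h] by (auto simp: isometry_def smooth_map_def)
  have cont_hq: "continuous_map euclidean (mtop M) (\<lambda>x. h (q x))"
    using continuous_map_compose[OF continuous_map_q iso(1)] by (simp add: o_def)
  have "open (F -` V)" if V: "open V" for V
    unfolding open_subopen[of "F -` V"]
  proof
    fix x0 assume "x0 \<in> F -` V"
    \<comment> \<open>For \<open>x\<close> near \<open>x0\<close>, \<open>h (q x)\<close> has a lift
      close to \<open>F x0\<close>; in this open set such a lift meets the criterion of
      \<open>uniq\<close> and so equals \<open>F x\<close>.\<close>
    let ?W = "{p. norm (- fst p \<star> snd p \<star> - g) < e} \<inter> (UNIV \<times> V)"
    have "continuous_on UNIV (\<lambda>p. norm (- fst p \<star> snd p \<star> - g))" by (intro continuous_intros)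
    then have "open ((\<lambda>p. norm (- fst p \<star> snd p \<star> - g)) -` {..<e})"
      by (simp add: continuous_on_open_vimage)
    moreover have "(\<lambda>p. norm (- fst p \<star> snd p \<star> - g)) -` {..<e} = {p. norm (- fst p \<star> snd p \<star> - g) < e}"
      by auto
    ultimately have "open ?W" using V by (intro open_Int open_Times) auto
    moreover have "(x0, F x0) \<in> ?W"
      using B(1)[of x0] \<open>x0 \<in> F -` V\<close> by (simp add: F_def star_assoc)
    ultimately obtain A C where AC: "open A" "open C" "(x0, F x0) \<in> A \<times> C" "A \<times> C \<subseteq> ?W"
      by (rule open_prod_elim)
    let ?O = "A \<inter> {x. h (q x) \<in> q ` C}"
    have "open {x. h (q x) \<in> q ` C}"
      using openin_continuous_map_preimage[OF cont_hq open_map_q[OF AC(2)]] by simp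
    then have "open ?O" using AC(1) by blast
    moreover have "x0 \<in> ?O" using AC(3) hF by auto
    moreover have "?O \<subseteq> F -` V"
    proof
      fix x assume x: "x \<in> ?O"
      then obtain y where y: "y \<in> C" "h (q x) = q y" by blast
      then have "(x, y) \<in> ?W" using AC(4) x by blast
      then have "y = F x" "y \<in> V" using uniq[of y x] y by auto
      then show "x \<in> F -` V" by simp
    qed
    ultimately show "\<exists>T. open T \<and> x0 \<in> T \<and> T \<subseteq> F -` V" by blast
  qed
  note open_F = this
  \<comment> \<open>In charts given by small balls around \<open>x0\<close> and \<open>F x0\<close>
    the local representative of \<open>h\<close> is \<open>F\<close>, which thus inherits smoothness
    and the isometry condition.\<close>
  have loc: "\<exists>O'. open O' \<and> x0 \<in> O' \<and> Ck_on 2 O' F \<and> linear_isometry K (frechet_derivative F (at x0))" for x0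
  proof -
    obtain r where r: "r > 0" "inj_on q (ball x0 r)" using q_inj_ball by blast
    obtain s where s: "s > 0" "inj_on q (ball (F x0) s)" using q_inj_ball by blast
    let ?U = "ball x0 r" and ?V = "ball (F x0) s"
    let ?i = "((), G ` ?U)" and ?j = "((), G ` ?V)"
    let ?O = "?U \<inter> F -` ?V" and ?f = "local_rep M ?i M ?j h"
    have ij: "?i \<in> chart_idx M" "?j \<in> chart_idx M" using r s by (simp_all add: chart_idx_M)
    have par: "parametrizes q ?U M ?i" using r by (simp add: parametrizes_M)
    have O: "open ?O" "x0 \<in> ?O" using open_F r s by auto
    have sub: "?O \<subseteq> local_dom M ?i M ?j h"
      by (auto simp: parametrizes_local_dom[OF par] chart_dom_M hF)
    have rep: "?f x = F x" if "x \<in> ?O" for x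
      using that s by (simp add: parametrizes_local_rep[OF par] hF chart_map_M)
    have "Ck_on 2 ?O ?f"
      using iso(2) ij sub Ck_on_subset unfolding smooth_in_charts_def smooth_on_def by blast
    then have Ck: "Ck_on 2 ?O F" using Ck_on_cong[OF O(1)] rep by blast
    have diff: "?f differentiable (at x0)"
      using \<open>Ck_on 2 ?O ?f\<close> O(2) unfolding numeral_2_eq_2 by (simp only: Ck_on.simps)
    then have fd: "frechet_derivative ?f (at x0) = frechet_derivative F (at x0)"
      using frechet_derivative_transform_within_open[OF diff O] rep by blast
    have "gram K = transpose (jacobian ?f (at x0)) ** gram K ** jacobian ?f (at x0)"
      using iso(3) ij sub O(2) unfolding preserves_metric_def Let_def chart_metric_M by blast
    then have "pinner K (jacobian ?f (at x0) *v v) (jacobian ?f (at x0) *v w) = pinner K v w" for v w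
      using gram_pullback_iff by blast
    moreover have lin: "linear (frechet_derivative ?f (at x0))" by (rule linear_frechet_derivative[OF diff])
    ultimately have "linear_isometry K (frechet_derivative F (at x0))"
      unfolding linear_isometry_def fd[symmetric] jacobian_def by (simp add: matrix_works)
    then show ?thesis using O Ck by blast
  qed
  have "Ck_on 2 UNIV F" by (rule Ck_on_local) (use loc in blast)
  then obtain A b where A: "linear_isometry K A" "F = (\<lambda>x. A x + b)"
    using C2_isometry_affine[of F K] loc by blast
  have linA: "linear A" using A(1) by (simp add: linear_isometry_def)
  \<comment> \<open>Equivariance at the point \<open>0\<close> reads
    \<open>A l + b = l \<star> b\<close>.\<close>
  have A_\<Lambda>: "A l = l + E l b" if "l \<in> \<Lambda>" for l
    using equi[OF that, of 0] by (simp add: A(2) star_def linear_0[OF linA] E.zero_right)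
  have lin2: "linear (\<lambda>v. v + E v b)"
    by (intro linear_compose_add linear_E_left) (simp add: linear_id[unfolded id_def])
  have "A v = v + E v b" for v
    using linear_eq_on[OF linA lin2, of v \<Lambda>] A_\<Lambda> span_\<Lambda> by simp
  then have "F x = x \<star> b" for x by (simp add: A(2) star_def add_ac)
  \<comment> \<open>\<open>pi_hom\<close> multiplies by the inverse, hence the sign of
    \<open>b\<close>.\<close>
  then have eq: "h (q x) = pi_hom K \<eta> \<Gamma> (G (- b)) (q x)" for x by (simp add: hF pi_hom_q)
  have "h = pi_hom K \<eta> \<Gamma> (G (- b))"
  proof (rule extensionalityI[of _ "range q"])
    show "h \<in> extensional (range q)" by (rule Isom_D(1)[OF h])
    show "pi_hom K \<eta> \<Gamma> (G (- b)) \<in> extensional (range q)" by (rule Isom_D(1)[OF pi_hom_Isom])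
  qed (use eq in blast)
  then show ?thesis by blast
qed

section \<open>The image of \<open>\<pi>\<close> as identity component\<close>

text \<open>Both halves use the lifting lemma: near a right translation every isometry is one, and
  an isometry \<open>f\<close> with a right translation \<open>h\<close> nearby is itself near
  \<open>h\<close>.\<close>

lemma clopen_pi_hom:
  "openin (Isom_top M) (pi_hom K \<eta> \<Gamma> ` range G)" "closedin (Isom_top M) (pi_hom K \<eta> \<Gamma> ` range G)"
proof -
  let ?P = "pi_hom K \<eta> \<Gamma> ` range G"
  obtain e where e: "e > 0" "\<And>x b b'. norm b < e \<Longrightarrow> norm b' < e \<Longrightarrow> q (x \<star> b) = q (x \<star> b') \<Longrightarrow> b = b'"
    using uniform_injectivity by blast
  have P: "?P \<subseteq> carrier (Isom M)" using pi_hom_Isom by blast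
  show "openin (Isom_top M) ?P"
    unfolding openin_subopen[of _ ?P]
  proof
    fix f assume "f \<in> ?P"
    then obtain X where f: "f = pi_hom K \<eta> \<Gamma> (G X)" by blast
    obtain N where N: "openin (Isom_top M) N" "f \<in> N"
      "\<And>h x. h \<in> N \<Longrightarrow> \<exists>b. norm b < e \<and> h (q x) = f (q (x \<star> b))"
      using Isom_top_neighbourhood[OF pi_hom_Isom[of X] e(1)] unfolding f[symmetric] by blast
    have "h \<in> ?P" if hN: "h \<in> N" for h
    proof -
      have h: "h \<in> carrier (Isom M)" using openin_subset[OF N(1)] hN by (auto simp: topspace_Isom_top)
      have near: "\<exists>b. norm b < e \<and> h (q x) = q (x \<star> b \<star> - X)" for x
        using N(3)[OF hN, of x] by (simp add: f pi_hom_q)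
      obtain Y where "h = pi_hom K \<eta> \<Gamma> (G Y)"
        using uniform_lift_imp_pi_hom[OF h _ near] e(2) by blast
      then show ?thesis by blast
    qed
    then show "\<exists>T. openin (Isom_top M) T \<and> f \<in> T \<and> T \<subseteq> ?P" using N by blast
  qed
  have "openin (Isom_top M) (carrier (Isom M) - ?P)"
    unfolding openin_subopen[of _ "carrier (Isom M) - ?P"]
  proof
    fix f assume f: "f \<in> carrier (Isom M) - ?P"
    obtain N where N: "openin (Isom_top M) N" "f \<in> N"
      "\<And>h x. h \<in> N \<Longrightarrow> \<exists>b. norm b < e \<and> h (q x) = f (q (x \<star> b))"
      using Isom_top_neighbourhood[OF _ e(1), of f] f by blast
    have fC: "f \<in> carrier (Isom M)" using f by blast
    have "h \<notin> ?P" if hN: "h \<in> N" for h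
    proof
      assume "h \<in> ?P"
      then obtain X where h: "h = pi_hom K \<eta> \<Gamma> (G X)" by blast
      have near: "\<exists>b. norm b < e \<and> f (q y) = q (y \<star> b \<star> - X)" for y
      proof -
        have "f ` range q = range q" "h ` range q = range q"
          using Isom_D(2)[OF fC] Isom_D(2)[OF pi_hom_Isom] unfolding h by (simp_all add: bij_betw_def)
        moreover have "f (q y) \<in> f ` range q" by (intro imageI rangeI)
        ultimately have "f (q y) \<in> h ` range q" by simp
        then obtain x where x: "f (q y) = h (q x)" by blast
        obtain b where b: "norm b < e" "h (q x) = f (q (x \<star> b))" using N(3)[OF hN] by blast
        have "f (q y) = f (q (x \<star> b))" using x b(2) by simp
        then have "q y = q (x \<star> b)"
          using inj_onD[OF bij_betw_imp_inj_on[OF Isom_D(2)[OF fC]]] by blast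
        then obtain l where l: "l \<in> \<Lambda>" "x \<star> b = l \<star> y" using q_eq_iff by blast
        \<comment> \<open>Reversing the displacement turns closeness of \<open>h\<close> to
          \<open>f\<close> at \<open>x\<close> into closeness of \<open>f\<close> to
          \<open>h\<close> at \<open>y\<close>, with right factor \<open>- b\<close>.\<close>
        then have "x = l \<star> y \<star> - b" by (metis star_cancel_right(1))
        then have "q (x \<star> - X) = q (y \<star> - b \<star> - X)" using l(1) by (simp add: star_assoc)
        then show ?thesis using b(1) x by (intro exI[of _ "- b"]) (simp add: h pi_hom_q)
      qed
      have "f \<in> ?P" using uniform_lift_imp_pi_hom[OF fC _ near] e(2) by blast
      then show False using f by blast
    qed
    moreover have "N \<subseteq> carrier (Isom M)" using openin_subset[OF N(1)] by (simp add: topspace_Isom_top)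
    ultimately show "\<exists>T. openin (Isom_top M) T \<and> f \<in> T \<and> T \<subseteq> carrier (Isom M) - ?P" using N by blast
  qed
  then show "closedin (Isom_top M) ?P" using P by (simp add: closedin_def topspace_Isom_top)
qed

text \<open>A compact \<open>C\<close> in \<open>M\<close> is the image of the compact set
  \<open>D\<close> in \<open>V\<close>. The condition that all of \<open>D\<close> be sent into
  \<open>U\<close> is open in \<open>X\<close> by the tube lemma.\<close>

lemma continuous_pi_hom: "continuous_map euclidean (Isom_top M) (\<lambda>X. pi_hom K \<eta> \<Gamma> (G X))"
  unfolding Isom_top_def
proof (rule continuous_on_generated_topo)
  show "(\<lambda>X. pi_hom K \<eta> \<Gamma> (G X)) ` topspace euclidean \<subseteq>
      \<Union>{{f \<in> carrier (Isom M). f ` C \<subseteq> U} |C U. compactin (mtop M) C \<and> openin (mtop M) U}"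
    using topspace_Isom_top pi_hom_Isom unfolding Isom_top_def by auto
next
  fix S assume "S \<in> {{f \<in> carrier (Isom M). f ` C \<subseteq> U} |C U. compactin (mtop M) C \<and> openin (mtop M) U}"
  then obtain C U where S: "S = {f \<in> carrier (Isom M). f ` C \<subseteq> U}" and C: "compactin (mtop M) C"
    and U: "openin (mtop M) U" by blast
  define D where "D = cball 0 R \<inter> q -` C"
  have "closedin (mtop M) C" by (rule compactin_imp_closedin[OF Hausdorff_M C])
  then have "closed (q -` C)"
    using closedin_continuous_map_preimage[OF continuous_map_q] by (simp add: vimage_def)
  then have D: "compact D" unfolding D_def by (intro compact_Int_closed) auto
  have qD: "C = q ` D"
  proof
    show "C \<subseteq> q ` D"
    proof
      fix p assume p: "p \<in> C"
      then obtain x where x: "p = q x" using compactin_subset_topspace[OF C] by (auto simp: topspace_M)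
      obtain l where "l \<in> \<Lambda>" "norm (l \<star> x) \<le> R" using R(2) by blast
      then show "p \<in> q ` D" using p x by (intro image_eqI[of _ _ "l \<star> x"]) (auto simp: D_def)
    qed
  qed (auto simp: D_def)
  have S_iff: "pi_hom K \<eta> \<Gamma> (G X) \<in> S \<longleftrightarrow> (\<forall>x\<in>D. q (x \<star> - X) \<in> U)" for X
    by (simp add: S pi_hom_Isom qD image_subset_iff pi_hom_q)
  let ?W = "(\<lambda>p. snd p \<star> - fst p) -` (q -` U)"
  have "continuous_on UNIV (\<lambda>p. snd p \<star> - fst p)" by (intro continuous_intros)
  then have W: "open ?W" using open_q_vimage[OF U] by (simp only: continuous_on_open_vimage[OF open_UNIV]) simp
  have "open {X. \<forall>x\<in>D. q (x \<star> - X) \<in> U}" (is "open ?S")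
    unfolding open_subopen[of ?S]
  proof
    fix X assume X: "X \<in> ?S"
    then have "{X} \<times> D \<subseteq> ?W" by auto
    then obtain A where A: "open A" "X \<in> A" "A \<times> D \<subseteq> ?W" using Elementary_Topology.tube_lemma[OF D W] by blast
    have "A \<subseteq> ?S"
    proof
      fix Y assume "Y \<in> A"
      then have "\<And>x. x \<in> D \<Longrightarrow> (Y, x) \<in> ?W" using A(3) by blast
      then show "Y \<in> ?S" by simp
    qed
    then show "\<exists>T. open T \<and> X \<in> T \<and> T \<subseteq> ?S" using A by blast
  qed
  then show "openin euclidean ((\<lambda>X. pi_hom K \<eta> \<Gamma> (G X)) -` S \<inter> topspace euclidean)"
    by (simp add: vimage_def S_iff)
qed

lemma pi_hom_0: "pi_hom K \<eta> \<Gamma> (G 0) = \<one>\<^bsub>Isom M\<^esub>"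
proof (rule extensionalityI[of _ "range q"])
  show "pi_hom K \<eta> \<Gamma> (G 0) \<in> extensional (range q)" by (rule Isom_D(1)[OF pi_hom_Isom])
qed (auto simp: Isom_one pi_hom_q)

lemma connected_component_Isom:
  "connected_component_of_set (Isom_top M) \<one>\<^bsub>Isom M\<^esub> = pi_hom K \<eta> \<Gamma> ` carrier L"
proof -
  let ?C = "connected_component_of_set (Isom_top M) \<one>\<^bsub>Isom M\<^esub>" and ?P = "pi_hom K \<eta> \<Gamma> ` range G"
  have "connectedin (Isom_top M) ((\<lambda>X. pi_hom K \<eta> \<Gamma> (G X)) ` UNIV)"
    by (rule connectedin_continuous_map_image[OF continuous_pi_hom]) (simp add: connected_UNIV)
  then have conn: "connectedin (Isom_top M) ?P" by (simp add: image_image)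
  have one: "\<one>\<^bsub>Isom M\<^esub> \<in> ?P" using pi_hom_0 by (metis imageI rangeI)
  have sub: "?P \<subseteq> ?C" by (rule connected_component_of_maximal[OF conn one])
  have "?C \<subseteq> ?P \<or> disjnt ?C ?P"
    by (rule connectedin_clopen_cases[OF connectedin_connected_component_of clopen_pi_hom(2,1)])
  then have "?C \<subseteq> ?P" using sub one unfolding disjnt_def by blast
  then show ?thesis using sub by (simp add: carrier_L)
qed

end

section \<open>Lattices from rational coefficients\<close>

context isotropic_three_vector
begin

text \<open>Reduces the lattice property to \<open>V\<close>: left translations carry the isolating
  set \<open>S\<close> from \<open>0\<close> to every lattice point, and the quotient is the
  continuous image of \<open>C\<close>.\<close>

lemma lattice_in_L_I:
  assumes \<Lambda>: "0 \<in> \<Lambda>" "\<And>x y. x \<in> \<Lambda> \<Longrightarrow> y \<in> \<Lambda> \<Longrightarrow> x \<star> y \<in> \<Lambda>" "\<And>x. x \<in> \<Lambda> \<Longrightarrow> - x \<in> \<Lambda>"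
    and S: "open S" "0 \<in> S" "\<And>x. x \<in> \<Lambda> \<Longrightarrow> x \<in> S \<Longrightarrow> x = 0"
    and C: "compact C" "\<And>x. \<exists>l\<in>\<Lambda>. l \<star> x \<in> C"
  shows "lattice_in_L K \<eta> (G ` \<Lambda>)"
proof -
  let ?\<Gamma> = "G ` \<Lambda>"
  have subgroup: "subgroup ?\<Gamma> L"
  proof (rule group.subgroupI[OF group_L])
    show "?\<Gamma> \<subseteq> carrier L" by (auto simp: carrier_L)
    show "?\<Gamma> \<noteq> {}" using \<Lambda>(1) by blast
  qed (auto simp: L_inv G_comp \<Lambda>)
  have "openin (top_of_set ?\<Gamma>) {g}" if g: "g \<in> ?\<Gamma>" for g
  proof -
    obtain x where x: "x \<in> \<Lambda>" "g = G x" using g by blast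
    have "continuous_on UNIV (\<lambda>y. - x \<star> y)" by (intro continuous_intros)
    then have "open ((\<lambda>y. - x \<star> y) -` S)" using S(1) by (simp add: continuous_on_open_vimage)
    then have "openin (top_of_set (range G)) (G ` ((\<lambda>y. - x \<star> y) -` S))" by (simp only: openin_L_image)
    then obtain V where V: "open V" "G ` ((\<lambda>y. - x \<star> y) -` S) = range G \<inter> V" by (auto simp: openin_open)
    have "{g} = ?\<Gamma> \<inter> V"
    proof
      have "G x \<in> G ` ((\<lambda>y. - x \<star> y) -` S)" using S(2) by simp
      then show "{g} \<subseteq> ?\<Gamma> \<inter> V" using V(2) x by blast
      show "?\<Gamma> \<inter> V \<subseteq> {g}"
      proof
        fix h assume h: "h \<in> ?\<Gamma> \<inter> V"
        then obtain y where y: "y \<in> \<Lambda>" "h = G y" by blast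
        then have "G y \<in> G ` ((\<lambda>y. - x \<star> y) -` S)" using h V(2) by blast
        then have "- x \<star> y \<in> S" by auto
        then have "- x \<star> y = 0" using S(3) \<Lambda> x y by blast
        then have "y = x" by (metis star_0(2) star_cancel(2))
        then show "h \<in> {g}" using x y by simp
      qed
    qed
    then show ?thesis using V(1) by (metis openin_open_Int)
  qed
  then have "discrete_topology ?\<Gamma> = top_of_set ?\<Gamma>" by (simp add: discrete_topology_unique)
  moreover have "subtopology (mtop (L_mfd K \<eta>)) ?\<Gamma> = top_of_set ?\<Gamma>"
    unfolding mtop_L subtopology_subtopology by (simp add: inf_absorb2 image_mono)
  ultimately have discrete: "subtopology (mtop (L_mfd K \<eta>)) ?\<Gamma> = discrete_topology ?\<Gamma>" by simp
  interpret Q: discrete_subgroup_L K \<eta> ?\<Gamma>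
    by (intro discrete_subgroup_L.intro discrete_subgroup_L_axioms.intro
        isotropic_three_vector_axioms subgroup discrete)
  have Q\<Lambda>: "Q.\<Lambda> = \<Lambda>" by (auto simp: Q.\<Lambda>_def)
  have "range Q.q = Q.q ` C"
  proof
    show "range Q.q \<subseteq> Q.q ` C"
    proof clarify
      fix x
      obtain l where "l \<in> \<Lambda>" "l \<star> x \<in> C" using C(2) by blast
      then show "Q.q x \<in> Q.q ` C" by (intro image_eqI[of _ _ "l \<star> x"]) (simp_all add: Q\<Lambda>)
    qed
  qed blast
  moreover have "compactin (mtop Q.M) (Q.q ` C)"
    by (rule image_compactin[of euclidean]) (simp_all add: C Q.continuous_map_q)
  ultimately have "compact_space (mtop Q.M)" by (simp add: compact_space_def Q.topspace_M)
  then show ?thesis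
    unfolding lattice_in_L_def using subgroup discrete by (simp add: M_mfd_def quotient_mfd_def)
qed

end

section \<open>The lattice attached to an adapted basis\<close>

text \<open>In the intended instance \<open>e\<close> is dual to the rational basis, so pairing with
  \<open>e p\<close> reads off a coefficient in that basis, and \<open>N\<close> is a common
  denominator. \<open>T\<close> spans all values of \<open>E\<close>, and \<open>B\<close> completes
  it by members of \<open>e\<close>.\<close>

locale rational_basis = isotropic_three_vector K \<eta>
  for K :: "'n::finite set" and \<eta> +
  fixes e :: "'n \<Rightarrow> real^'n" and T B :: "(real^'n) set" and N :: nat
  assumes span_e: "span (range e) = UNIV"
    and N_pos: "N > 0"
    and integral: "\<And>p i j. real N * pinner K (e p) (E (e i) (e j)) \<in> \<int>"
    and T_subset: "T \<subseteq> {E (e i) (e j) |i j. True}"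
    and E_e_span: "\<And>i j. E (e i) (e j) \<in> span T"
    and B: "T \<subseteq> B" "B \<subseteq> T \<union> range e" "independent B" "span B = UNIV"
begin

definition coord :: "real^'n \<Rightarrow> real^'n \<Rightarrow> real" where "coord v x = representation B x v"

lemma finite_B: "finite B"
  using B(3) by (rule independent_imp_finite)

lemma linear_coord: "linear (coord v)"
  by (rule linearI) (simp_all add: coord_def representation_add representation_scale B)

lemma coord_B: "w \<in> B \<Longrightarrow> coord v w = (if v = w then 1 else 0)"
  using representation_basis[OF B(3)] by (simp add: coord_def)

lemma coord_expansion: "(\<Sum>v\<in>B. coord v x *\<^sub>R v) = x"
  unfolding coord_def by (rule sum_representation_eq) (use B finite_B in auto)

lemma coord_sum: "v \<in> B \<Longrightarrow> coord v (\<Sum>w\<in>B. k w *\<^sub>R w) = k v"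
  by (simp add: linear_sum[OF linear_coord] linear_cmul[OF linear_coord] coord_B finite_B if_distrib cong: if_cong)

lemma coord_span_T: "s \<in> span T \<Longrightarrow> v \<in> B - T \<Longrightarrow> coord v s = 0"
proof (induction rule: span_induct_alt)
  case base
  then show ?case by (simp add: linear_0[OF linear_coord])
next
  case (step c x y)
  then have "coord v x = 0" using coord_B[of x v] B(1) by auto
  then show ?case using step by (simp add: linear_add[OF linear_coord] linear_cmul[OF linear_coord])
qed

text \<open>The projection with kernel \<open>span T\<close>. As \<open>span T\<close> is
  annihilated by \<open>E\<close>, the form \<open>E\<close> factors through it.\<close>

definition proj_D :: "real^'n \<Rightarrow> real^'n" where "proj_D x = (\<Sum>v\<in>B - T. coord v x *\<^sub>R v)"

lemma linear_proj_D: "linear proj_D"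
  unfolding proj_D_def
  by (rule linearI)
    (simp_all add: linear_add[OF linear_coord] linear_cmul[OF linear_coord] scaleR_add_left sum.distrib scaleR_sum_right)

lemma proj_D_span_T: "s \<in> span T \<Longrightarrow> proj_D s = 0"
  by (simp add: proj_D_def coord_span_T)

lemma diff_proj_D: "x - proj_D x = (\<Sum>v\<in>T. coord v x *\<^sub>R v)"
proof -
  have "(\<Sum>v\<in>B. coord v x *\<^sub>R v) = proj_D x + (\<Sum>v\<in>T. coord v x *\<^sub>R v)"
    unfolding proj_D_def by (rule sum.subset_diff[OF B(1) finite_B])
  then have "x = proj_D x + (\<Sum>v\<in>T. coord v x *\<^sub>R v)" using coord_expansion[of x] by simp
  then show ?thesis by (metis add_diff_cancel_left')
qed

lemma diff_proj_D_span: "x - proj_D x \<in> span T"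
  unfolding diff_proj_D by (intro span_sum span_scale span_base)

lemma span_T_support: "span T \<subseteq> support K \<eta>"
  unfolding support_def by (rule span_mono) (use T_subset in blast)

lemma E_span_T: "E x y \<in> span T"
proof -
  have 1: "E x (e j) \<in> span T" for x j
  proof -
    have "x \<in> span (range e)" by (simp add: span_e)
    then show ?thesis
      by (induction rule: span_induct_alt)
        (auto simp: E.zero_left E.add_left E.scaleR_left E_e_span intro!: span_add span_scale span_zero)
  qed
  have "y \<in> span (range e)" by (simp add: span_e)
  then show ?thesis
    by (induction rule: span_induct_alt)
      (auto simp: E.zero_right E.add_right E.scaleR_right 1 intro!: span_add span_scale span_zero)
qed

lemma E_proj_D: "E (proj_D x) (proj_D y) = E x y"
proof -
  have "E (x - proj_D x) z = 0" "E z (x - proj_D x) = 0" for x z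
    using diff_proj_D_span span_T_support E_support_left E_support_right by blast+
  then have "E (proj_D x) z = E x z" "E z (proj_D x) = E z x" for x z
    by (simp_all add: E.diff_left E.diff_right)
  then show ?thesis by simp
qed

text \<open>Along \<open>T\<close> integrality is tested by pairings with the \<open>e p\<close>
  instead of coordinates: these pairings are what \<open>integral\<close> controls for values of
  \<open>E\<close>, giving closure under \<open>\<star>\<close>.\<close>

definition \<Lambda> :: "(real^'n) set" where
  "\<Lambda> = {x. (\<forall>v\<in>B - T. coord v x \<in> \<int>) \<and> (\<forall>p. real N * pinner K (e p) (x - proj_D x) \<in> \<int>)}"

text \<open>Only components along \<open>B - T\<close> enter \<open>E\<close>. They are integers,
  and the basis vectors there belong to \<open>e\<close>, so \<open>integral\<close> applies to each
  term.\<close>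

lemma N_pinner_E:
  assumes "x \<in> \<Lambda>" "y \<in> \<Lambda>"
  shows "real N * pinner K (e p) (E x y) \<in> \<int>"
proof -
  have "E x y = (\<Sum>v\<in>B - T. \<Sum>w\<in>B - T. (coord v x * coord w y) *\<^sub>R E v w)"
    unfolding E_proj_D[of x y, symmetric] proj_D_def
    by (simp add: E.sum_left E.sum_right E.scaleR_left E.scaleR_right scaleR_sum_right) (subst sum.swap, simp add: mult.commute)
  then have "real N * pinner K (e p) (E x y) =
      (\<Sum>v\<in>B - T. \<Sum>w\<in>B - T. coord v x * coord w y * (real N * pinner K (e p) (E v w)))"
    by (simp add: pinner_sum_right pinner_scale_right sum_distrib_left mult_ac)
  also have "\<dots> \<in> \<int>"
  proof (intro Ints_sum)
    fix v w assume vw: "v \<in> B - T" "w \<in> B - T"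
    then have "coord v x \<in> \<int>" "coord w y \<in> \<int>" using assms by (auto simp: \<Lambda>_def)
    moreover obtain i j where "v = e i" "w = e j" using vw B(2) by blast
    ultimately show "coord v x * coord w y * (real N * pinner K (e p) (E v w)) \<in> \<int>"
      using Ints_mult[OF Ints_mult integral] by simp
  qed
  finally show ?thesis .
qed

lemma \<Lambda>_star: "x \<in> \<Lambda> \<Longrightarrow> y \<in> \<Lambda> \<Longrightarrow> x \<star> y \<in> \<Lambda>"
proof -
  assume xy: "x \<in> \<Lambda>" "y \<in> \<Lambda>"
  have "coord v (x \<star> y) = coord v x + coord v y" if "v \<in> B - T" for v
    using coord_span_T[OF E_span_T that] by (simp add: star_def linear_add[OF linear_coord])
  moreover have "real N * pinner K (e p) (x \<star> y - proj_D (x \<star> y)) =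
      real N * pinner K (e p) (x - proj_D x) + real N * pinner K (e p) (y - proj_D y)
      + real N * pinner K (e p) (E x y)" for p
  proof -
    have "x \<star> y - proj_D (x \<star> y) = (x - proj_D x) + (y - proj_D y) + E x y"
      using proj_D_span_T[OF E_span_T[of x y]] by (simp add: star_def linear_add[OF linear_proj_D])
    then show ?thesis by (simp add: pinner_add_right distrib_left)
  qed
  ultimately show ?thesis using xy N_pinner_E[OF xy] by (simp add: \<Lambda>_def)
qed

lemma \<Lambda>_minus: "x \<in> \<Lambda> \<Longrightarrow> - x \<in> \<Lambda>"
proof -
  assume x: "x \<in> \<Lambda>"
  have "- x - proj_D (- x) = - (x - proj_D x)" by (simp add: linear_neg[OF linear_proj_D])
  then have "pinner K (e p) (- x - proj_D (- x)) = - pinner K (e p) (x - proj_D x)" for p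
    by (simp only: linear_neg[OF linear_pinner_right])
  then show ?thesis using x by (simp add: \<Lambda>_def linear_neg[OF linear_coord])
qed

lemma \<Lambda>_0: "0 \<in> \<Lambda>"
  by (simp add: \<Lambda>_def linear_0[OF linear_coord] linear_0[OF linear_proj_D])

text \<open>Supplies the elements needed for cocompactness: vectors of \<open>T\<close> are values
  \<open>E (e i) (e j)\<close>, so their pairings are integral after scaling by
  \<open>N\<close>.\<close>

lemma \<Lambda>_integral_combination:
  assumes "\<And>v. k v \<in> \<int>"
  shows "(\<Sum>v\<in>B. k v *\<^sub>R v) \<in> \<Lambda>"
proof -
  let ?x = "\<Sum>v\<in>B. k v *\<^sub>R v"
  have k: "coord v ?x = k v" if "v \<in> B" for v using that by (rule coord_sum)
  have "real N * pinner K (e p) (?x - proj_D ?x) = (\<Sum>v\<in>T. k v * (real N * pinner K (e p) v))" for p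
  proof -
    have "?x - proj_D ?x = (\<Sum>v\<in>T. k v *\<^sub>R v)"
      unfolding diff_proj_D by (rule sum.cong) (use k B(1) in auto)
    then show ?thesis by (simp add: pinner_sum_right pinner_scale_right sum_distrib_left mult_ac)
  qed
  moreover have "(\<Sum>v\<in>T. k v * (real N * pinner K (e p) v)) \<in> \<int>" for p
  proof (rule Ints_sum)
    fix v assume "v \<in> T"
    then obtain i j where "v = E (e i) (e j)" using T_subset by blast
    then show "k v * (real N * pinner K (e p) v) \<in> \<int>" using Ints_mult[OF assms[of v] integral[of p i j]] by simp
  qed
  ultimately show ?thesis using k assms by (simp add: \<Lambda>_def)
qed

text \<open>Integers of absolute value below 1 vanish, so \<open>x\<close> has no component along
  \<open>B - T\<close> and is orthogonal to the spanning family \<open>e\<close>.\<close>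

lemma \<Lambda>_small:
  assumes "x \<in> \<Lambda>" "\<And>v. v \<in> B - T \<Longrightarrow> \<bar>coord v x\<bar> < 1"
    "\<And>p. \<bar>real N * pinner K (e p) (x - proj_D x)\<bar> < 1"
  shows "x = 0"
proof -
  have "coord v x = 0" if "v \<in> B - T" for v
    using assms(1,2) that Ints_nonzero_abs_less1 unfolding \<Lambda>_def by blast
  then have P: "proj_D x = 0" by (simp add: proj_D_def)
  have "real N * pinner K (e p) (x - proj_D x) = 0" for p
    using assms(1,3) Ints_nonzero_abs_less1 unfolding \<Lambda>_def by blast
  then have 0: "pinner K (e p) x = 0" for p using N_pos by (simp add: P)
  have "pinner K z x = 0" for z
  proof -
    have "z \<in> span (range e)" by (simp add: span_e)
    then show ?thesis
      by (induction rule: span_induct_alt) (auto simp: pinner_add_left pinner_scale_left 0)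
  qed
  then show ?thesis using pinner_nondegenerate pinner_commute by metis
qed

lemma \<Lambda>_discrete: "\<exists>S. open S \<and> 0 \<in> S \<and> (\<forall>x\<in>\<Lambda>. x \<in> S \<longrightarrow> x = 0)"
proof -
  let ?S = "(\<Inter>v\<in>B - T. {x. \<bar>coord v x\<bar> < 1}) \<inter> (\<Inter>p. {x. \<bar>real N * pinner K (e p) (x - proj_D x)\<bar> < 1})"
  have coord: "continuous_on UNIV (coord v)" for v
    using linear_continuous_on linear_coord linear_conv_bounded_linear by blast
  have "linear (\<lambda>x. pinner K (e p) (x - proj_D x))" for p
    using linear_compose[OF linear_compose_sub[OF linear_id linear_proj_D] linear_pinner_right]
    by (simp add: o_def)
  then have pin: "continuous_on UNIV (\<lambda>x. pinner K (e p) (x - proj_D x))" for p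
    using linear_continuous_on linear_conv_bounded_linear by blast
  have "open ?S"
    by (intro open_Int open_INT ballI open_Collect_less continuous_intros coord pin) (use finite_B in auto)
  moreover have "0 \<in> ?S" by (simp add: linear_0[OF linear_coord] linear_0[OF linear_proj_D])
  ultimately show ?thesis using \<Lambda>_small by (intro exI[of _ ?S]) auto
qed

text \<open>The coordinates along \<open>B - T\<close> are reduced first; the coordinates along \<open>T\<close> can then be
  reduced independently because \<open>T\<close> is central.\<close>

lemma \<Lambda>_cocompact: "\<exists>l\<in>\<Lambda>. norm (l \<star> x) \<le> (\<Sum>v\<in>B. norm v)"
proof -
  \<comment> \<open>\<open>l0\<close> carries only the coordinates outside \<open>T\<close>. Since
    \<open>E l x\<close> depends on no others, the shift \<open>E l0 x\<close> is known before the
    coordinates along \<open>T\<close> are chosen.\<close>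
  define k0 where "k0 v = (if v \<in> T then 0 else - of_int \<lfloor>coord v x\<rfloor> :: real)" for v
  define l0 where "l0 = (\<Sum>v\<in>B. k0 v *\<^sub>R v)"
  define k where "k v = (if v \<in> T then - of_int \<lfloor>coord v (x + E l0 x)\<rfloor> else - of_int \<lfloor>coord v x\<rfloor> :: real)" for v
  define l where "l = (\<Sum>v\<in>B. k v *\<^sub>R v)"
  have l: "l \<in> \<Lambda>" unfolding l_def by (rule \<Lambda>_integral_combination) (simp add: k_def)
  have "proj_D l = proj_D l0"
    unfolding proj_D_def
    by (rule sum.cong) (auto simp: l_def l0_def coord_sum k_def k0_def)
  then have El: "E l x = E l0 x" using E_proj_D by metis
  have frac: "\<bar>- of_int \<lfloor>r\<rfloor> + r\<bar> \<le> 1" for r :: real by linarith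
  have "\<bar>coord v (l \<star> x)\<bar> \<le> 1" if v: "v \<in> B" for v
  proof (cases "v \<in> T")
    case True
    then have "coord v (l \<star> x) = - of_int \<lfloor>coord v (x + E l0 x)\<rfloor> + coord v (x + E l0 x)"
      using v by (simp add: star_def El linear_add[OF linear_coord]) (simp add: l_def coord_sum k_def linear_add[OF linear_coord])
    then show ?thesis using frac by metis
  next
    case False
    then have "coord v (l \<star> x) = - of_int \<lfloor>coord v x\<rfloor> + coord v x"
      using v coord_span_T[OF E_span_T, of v l x] by (simp add: star_def linear_add[OF linear_coord]) (simp add: l_def coord_sum k_def)
    then show ?thesis using frac by metis
  qed
  then have "norm (\<Sum>v\<in>B. coord v (l \<star> x) *\<^sub>R v) \<le> (\<Sum>v\<in>B. norm v)"
    by (intro sum_norm_le) (simp add: mult_left_le_one_le)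
  then show ?thesis using l by (auto simp: coord_expansion)
qed

lemma lattice: "lattice_in_L K \<eta> (G ` \<Lambda>)"
proof -
  obtain S where S: "open S" "0 \<in> S" "\<And>x. x \<in> \<Lambda> \<Longrightarrow> x \<in> S \<Longrightarrow> x = 0" using \<Lambda>_discrete by blast
  have C: "\<exists>l\<in>\<Lambda>. l \<star> x \<in> cball 0 (\<Sum>v\<in>B. norm v)" for x using \<Lambda>_cocompact[of x] by auto
  show ?thesis by (rule lattice_in_L_I[OF \<Lambda>_0 \<Lambda>_star \<Lambda>_minus S compact_cball C])
qed

end

section \<open>From rational coefficients to an adapted basis\<close>

lemma common_denominator:
  fixes A :: "real set"
  assumes "finite A" "A \<subseteq> \<rat>"
  shows "\<exists>N::nat. N > 0 \<and> (\<forall>x\<in>A. real N * x \<in> \<int>)"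
  using assms
proof (induction A rule: finite_induct)
  case empty
  then show ?case by (intro exI[of _ 1]) simp
next
  case (insert x A)
  then obtain N where N: "N > 0" "\<forall>y\<in>A. real N * y \<in> \<int>" by auto
  obtain a b where x: "b > 0" "x = of_int a / of_int b"
    using insert.prems by (auto elim: Rats_cases')
  define M where "M = N * nat b"
  have M: "real M = real N * of_int b" using x(1) by (simp add: M_def)
  have "real M * x \<in> \<int>" using x by (simp add: M)
  moreover have "real M * y \<in> \<int>" if "y \<in> A" for y
  proof -
    have "real M * y = of_int b * (real N * y)" by (simp add: M)
    then show ?thesis using N(2) that by (metis Ints_mult Ints_of_int)
  qed
  moreover have "M > 0" using N(1) x(1) by (simp add: M_def)
  ultimately show ?case by blast
qed

lemma (in isotropic_three_vector) rational_coefficients_imp_lattice: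
  assumes "rational_coefficients K \<eta>"
  shows "\<exists>\<Gamma>. lattice_in_L K \<eta> \<Gamma>"
proof -
  obtain b c where b: "span (range b) = (UNIV :: (real^'n) set)"
    and c: "\<And>i j m :: 'n. c i j m \<in> \<rat>"
    and \<eta>: "\<And>X Y Z. \<eta> X Y Z = (\<Sum>i\<in>UNIV. \<Sum>j\<in>UNIV. \<Sum>m\<in>UNIV.
              c i j m * pinner K (b i) X * pinner K (b j) Y * pinner K (b m) Z)"
    using assms unfolding rational_coefficients_def by blast
  \<comment> \<open>The pairings with the basis \<open>b\<close>. By nondegeneracy
    \<open>\<Phi>\<close> is bijective, and preimages of the standard basis form the dual basis
    \<open>e\<close>.\<close>
  define \<Phi> where "\<Phi> x = (\<chi> i. pinner K (b i) x)" for x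
  have lin: "linear \<Phi>"
    by (rule linearI) (simp_all add: \<Phi>_def vec_eq_iff pinner_add_right pinner_scale_right)
  have "x = 0" if "\<Phi> x = 0" for x
  proof -
    have 0: "pinner K (b i) x = 0" for i using that by (simp add: \<Phi>_def vec_eq_iff)
    have "pinner K z x = 0" for z
    proof -
      have "z \<in> span (range b)" by (simp add: b)
      then show ?thesis
        by (induction rule: span_induct_alt) (auto simp: pinner_add_left pinner_scale_left 0)
    qed
    then show ?thesis using pinner_nondegenerate pinner_commute by metis
  qed
  then have "inj \<Phi>" using linear_injective_0[OF lin] by blast
  then have "surj \<Phi>" using linear_injective_imp_surjective[OF lin] by blast
  define e where "e j = inv_into UNIV \<Phi> (axis j 1)" for j
  have e: "\<Phi> (e j) = axis j 1" for j unfolding e_def by (rule surj_f_inv_f[OF \<open>surj \<Phi>\<close>])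
  have dual: "pinner K (b i) (e j) = (if i = j then 1 else 0)" for i j
  proof -
    have "pinner K (b i) (e j) = \<Phi> (e j) $ i" by (simp add: \<Phi>_def)
    then show ?thesis unfolding e by (simp add: axis_def)
  qed
  have span_e: "span (range e) = UNIV"
  proof -
    have "x \<in> span (range e)" for x
    proof -
      have "\<Phi> x = \<Phi> (\<Sum>j\<in>UNIV. pinner K (b j) x *\<^sub>R e j)"
        by (simp add: \<Phi>_def vec_eq_iff pinner_sum_right pinner_scale_right dual if_distrib cong: if_cong)
      then have "x = (\<Sum>j\<in>UNIV. pinner K (b j) x *\<^sub>R e j)" using \<open>inj \<Phi>\<close> by (simp only: inj_eq)
      moreover have "\<dots> \<in> span (range e)" by (intro span_sum span_scale span_base rangeI)
      ultimately show ?thesis by simp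
    qed
    then show ?thesis by blast
  qed
  \<comment> \<open>The coefficients of \<open>\<eta>\<close> reappear as the coordinates of
    \<open>E (e i) (e j)\<close> in the basis \<open>b\<close>, so finitely many rationals need a
    common denominator.\<close>
  have E_e: "pinner K (e p) (E (e i) (e j)) = c i j p" for p i j
    unfolding pinner_commute[of K "e p"] pinner_E
    by (simp add: \<eta> dual if_distrib[of "\<lambda>x. _ * x"] if_distribR cong: if_cong)
  have "finite (range (\<lambda>(i, j, m). c i j m))" "range (\<lambda>(i, j, m). c i j m) \<subseteq> \<rat>"
    using c by auto
  from common_denominator[OF this] obtain N where
    N_pos: "N > 0" and N_int: "\<forall>x\<in>range (\<lambda>(i, j, m). c i j m). real N * x \<in> \<int>" by blast
  have N: "real N * c i j m \<in> \<int>" for i j m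
    using bspec[OF N_int rangeI[of _ "(i, j, m)"]] by simp
  define S0 where "S0 = {E (e i) (e j) |i j. True}"
  obtain T where T: "T \<subseteq> S0" "independent T" "S0 \<subseteq> span T"
    using maximal_independent_subset by blast
  \<comment> \<open>Extending inside \<open>T \<union> range e\<close> ensures that the vectors
    added to \<open>T\<close> are members of \<open>e\<close>.\<close>
  obtain B where B: "T \<subseteq> B" "B \<subseteq> T \<union> range e" "independent B" "T \<union> range e \<subseteq> span B"
    using maximal_independent_subset_extend[of T "T \<union> range e"] T(2) by blast
  have spanB: "span B = UNIV"
    using span_minimal[of "range e" "span B"] B(4) span_e by auto
  interpret rational_basis K \<eta> e T B N
  proof (intro rational_basis.intro rational_basis_axioms.intro isotropic_three_vector_axioms)
    show "real N * pinner K (e p) (E (e i) (e j)) \<in> \<int>" for p i j by (simp add: E_e N)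
    show "T \<subseteq> {E (e i) (e j) |i j. True}" using T(1) by (simp add: S0_def)
    show "E (e i) (e j) \<in> span T" for i j using T(3) unfolding S0_def by blast
  qed (rule span_e N_pos B spanB)+
  show ?thesis using lattice by blast
qed

theorem corollary3:
  fixes K :: "'n::finite set" and k l :: nat
    and \<eta> :: "real^'n \<Rightarrow> real^'n \<Rightarrow> real^'n \<Rightarrow> real"
  assumes "card K = k" and "card (- K) = l"
    and "three_vector \<eta>"
    and "isotropic K (support K \<eta>)"
  shows "(rational_coefficients K \<eta> \<longrightarrow> (\<exists>\<Gamma>. lattice_in_L K \<eta> \<Gamma>)) \<and>
    (\<forall>\<Gamma>. lattice_in_L K \<eta> \<Gamma> \<longrightarrow>
       pseudo_riemannian (M_mfd K \<eta> \<Gamma>) \<and>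
       local_isometry (L_mfd K \<eta>) (M_mfd K \<eta> \<Gamma>) (coset_proj K \<eta> \<Gamma>) \<and>
       flat (M_mfd K \<eta> \<Gamma>) \<and>
       compact_space (mtop (M_mfd K \<eta> \<Gamma>)) \<and>
       homogeneous (M_mfd K \<eta> \<Gamma>) \<and>
       pi_hom K \<eta> \<Gamma> \<in> hom (L_group K \<eta>) (Isom (M_mfd K \<eta> \<Gamma>)) \<and>
       connected_component_of_set (Isom_top (M_mfd K \<eta> \<Gamma>)) \<one>\<^bsub>Isom (M_mfd K \<eta> \<Gamma>)\<^esub>
         = pi_hom K \<eta> \<Gamma> ` carrier (L_group K \<eta>))"
proof (intro conjI impI allI)
  interpret isotropic_three_vector K \<eta> by (rule isotropic_three_vector.intro[OF assms(3,4)])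
  show "\<exists>\<Gamma>. lattice_in_L K \<eta> \<Gamma>" if "rational_coefficients K \<eta>"
    using that by (rule rational_coefficients_imp_lattice)
  fix \<Gamma> assume lattice: "lattice_in_L K \<eta> \<Gamma>"
  then have compact: "compact_space (mtop (M_mfd K \<eta> \<Gamma>))"
    by (simp add: lattice_in_L_def M_mfd_def quotient_mfd_def)
  interpret discrete_subgroup_L K \<eta> \<Gamma>
    using lattice unfolding lattice_in_L_def
    by (intro discrete_subgroup_L.intro discrete_subgroup_L_axioms.intro isotropic_three_vector_axioms) auto
  interpret lattice_L K \<eta> \<Gamma>
    by (intro lattice_L.intro lattice_L_axioms.intro discrete_subgroup_L_axioms compact)
  show "pseudo_riemannian M" by (rule pseudo_riemannian_M)
  show "local_isometry (L_mfd K \<eta>) M (coset_proj K \<eta> \<Gamma>)" by (rule local_isometry_coset_proj)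
  show "flat M" by (rule flat_M)
  show "compact_space (mtop M)" by (rule compact)
  show "homogeneous M" by (rule homogeneous_M)
  show "pi_hom K \<eta> \<Gamma> \<in> hom L (Isom M)" by (rule pi_hom_hom)
  show "connected_component_of_set (Isom_top M) \<one>\<^bsub>Isom M\<^esub> = pi_hom K \<eta> \<Gamma> ` carrier L"
    by (rule connected_component_Isom)
qed

end
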